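(* For every $t\in(1,\infty)$, the real nilpotent Lie algebra $\tilde{\mathfrak{n}}_t=(\mathbb{R}^9,\tilde\mu_t)$ is not an Einstein nilradical.
   Context: Let $e_1,\dots,e_9$ be the canonical basis of $\mathbb{R}^9$. For $t\in\mathbb{R}$, $\tilde{\mathfrak{n}}_t=(\mathbb{R}^9,\tilde\mu_t)$ is the real $2$-step nilpotent Lie algebra whose bracket $\tilde\mu_t$ is the skew-symmetric bilinear map determined by $$\tilde\mu_t(e_5,e_4)=e_7,\quad \tilde\mu_t(e_1,e_6)=e_8,\quad \tilde\mu_t(e_3,e_2)=e_9,$$ $$\tilde\mu_t(e_3,e_6)=t\,e_7,\quad \tilde\mu_t(e_5,e_2)=t\,e_8,\quad \tilde\mu_t(e_1,e_4)=t\,e_9,\quad \tilde\mu_t(e_1,e_2)=e_7,$$ all other brackets of basis vectors not obtained from these by skew-symmetry being zero. Einstein nilradical: a real nilpotent Lie algebra $\mathfrak{n}$ is called an Einstein nilradical if it is the nilradical (maximal nilpotent ideal) of the Lie algebra of a (standard) Einstein solvmanifold. Equivalently, $\mathfrak{n}$ admits an inner product $\langle\cdot,\cdot\rangle$ such that $\mathrm{Ric}_{\langle\cdot,\cdot\rangle}=cI+D$ for some $c\in\mathbb{R}$ and some derivation $D\in\mathrm{Der}(\mathfrak{n})$. Here $\mathrm{Ric}_{\langle\cdot,\cdot\rangle}$ is the Ricci operator of the corresponding left invariant metric on the simply connected Lie group with Lie algebra $\mathfrak{n}$; for a nilpotent Lie algebra with bracket $\mu$ and any orthonormal basis $\{x_i\}$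 of $(\mathfrak{n},\langle\cdot,\cdot\rangle)$ it is given by $$\langle \mathrm{Ric}\,X,Y\rangle=-\tfrac12\sum_{i,j}\langle\mu(X,x_i),x_j\rangle\langle\mu(Y,x_i),x_j\rangle+\tfrac14\sum_{i,j}\langle\mu(x_i,x_j),X\rangle\langle\mu(x_i,x_j),Y\rangle .$$ *)

theory Defs
  imports "HOL-Analysis.Analysis"
begin

definition is_lie_bracket :: "('a::real_vector \<Rightarrow> 'a \<Rightarrow> 'a) \<Rightarrow> bool" where
  "is_lie_bracket br \<longleftrightarrow> bilinear br \<and> (\<forall>x. br x x = 0) \<and>
     (\<forall>x y z. br x (br y z) + br y (br z x) + br z (br x y) = 0)"

definition bracket_span :: "('a::real_vector \<Rightarrow> 'a \<Rightarrow> 'a) \<Rightarrow> 'a set \<Rightarrow> 'a set \<Rightarrow> 'a set" where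
  "bracket_span br A B = span {br x y | x y. x \<in> A \<and> y \<in> B}"

primrec derived_series :: "('a::real_vector \<Rightarrow> 'a \<Rightarrow> 'a) \<Rightarrow> nat \<Rightarrow> 'a set" where
  "derived_series br 0 = UNIV"
| "derived_series br (Suc k) = bracket_span br (derived_series br k) (derived_series br k)"

definition solvable_lie :: "('a::real_vector \<Rightarrow> 'a \<Rightarrow> 'a) \<Rightarrow> bool" where
  "solvable_lie br \<longleftrightarrow> (\<exists>k. derived_series br k = {0})"

primrec lower_central :: "('a::real_vector \<Rightarrow> 'a \<Rightarrow> 'a) \<Rightarrow> 'a set \<Rightarrow> nat \<Rightarrow> 'a set" where
  "lower_central br N 0 = N"
| "lower_central br N (Suc k) = bracket_span br N (lower_central br N k)"

definition nilpotent_ideal :: "('a::real_vector \<Rightarrow> 'a \<Rightarrow> 'a) \<Rightarrow> 'a set \<Rightarrow> bool" where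
  "nilpotent_ideal br N \<longleftrightarrow> subspace N \<and> (\<forall>x. \<forall>y\<in>N. br x y \<in> N) \<and>
     (\<exists>k. lower_central br N k = {0})"

definition is_nilradical :: "('a::real_vector \<Rightarrow> 'a \<Rightarrow> 'a) \<Rightarrow> 'a set \<Rightarrow> bool" where
  "is_nilradical br N \<longleftrightarrow> nilpotent_ideal br N \<and> (\<forall>I. nilpotent_ideal br I \<longrightarrow> I \<subseteq> N)"

text \<open>The Levi-Civita connection of the left invariant metric on the simply connected Lie group with
  Lie algebra \<open>(\<real>\<^sup>m, br)\<close> whose value at the identity is the inner product of the type, evaluated on
  left invariant fields.  It is given by the Koszul formula
  \<open>2 \<langle>\<nabla>\<^sub>x y, z\<rangle> = \<langle>[x,y], z\<rangle> - \<langle>[y,z], x\<rangle> + \<langle>[z,x], y\<rangle>\<close>.\<close>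

definition levi_civita :: "('a::euclidean_space \<Rightarrow> 'a \<Rightarrow> 'a) \<Rightarrow> 'a \<Rightarrow> 'a \<Rightarrow> 'a" where
  "levi_civita br x y =
     (\<Sum>b\<in>Basis. ((br x y \<bullet> b - br y b \<bullet> x + br b x \<bullet> y) / 2) *\<^sub>R b)"

definition curvature :: "('a::euclidean_space \<Rightarrow> 'a \<Rightarrow> 'a) \<Rightarrow> 'a \<Rightarrow> 'a \<Rightarrow> 'a \<Rightarrow> 'a" where
  "curvature br x y z =
     levi_civita br x (levi_civita br y z) - levi_civita br y (levi_civita br x z)
       - levi_civita br (br x y) z"

definition ricci :: "('a::euclidean_space \<Rightarrow> 'a \<Rightarrow> 'a) \<Rightarrow> 'a \<Rightarrow> 'a \<Rightarrow> real" where
  "ricci br x y = (\<Sum>b\<in>Basis. curvature br b x y \<bullet> b)"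

definition standard_metric :: "('a::euclidean_space \<Rightarrow> 'a \<Rightarrow> 'a) \<Rightarrow> bool" where
  "standard_metric br \<longleftrightarrow>
     (\<forall>x \<in> orthogonal_comp (bracket_span br UNIV UNIV).
      \<forall>y \<in> orthogonal_comp (bracket_span br UNIV UNIV). br x y = 0)"

definition standard_einstein_solvmanifold :: "('a::euclidean_space \<Rightarrow> 'a \<Rightarrow> 'a) \<Rightarrow> bool" where
  "standard_einstein_solvmanifold br \<longleftrightarrow>
     is_lie_bracket br \<and> solvable_lie br \<and> standard_metric br \<and>
     (\<exists>c. \<forall>x y. ricci br x y = c * (x \<bullet> y))"

text \<open>A finite-dimensional inner product space is a type of class \<open>euclidean_space\<close>.  The solvable Lie
  algebra may have any dimension, and HOL cannot quantify over types inside a formula, so its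
  underlying inner product space \<open>'s\<close> is a type parameter.  An algebra fails to be an Einstein
  nilradical if the predicate fails for every \<open>'s\<close>.\<close>

definition einstein_nilradical ::
    "'s::euclidean_space itself \<Rightarrow> ('n::real_vector \<Rightarrow> 'n \<Rightarrow> 'n) \<Rightarrow> bool" where
  "einstein_nilradical S \<mu> \<longleftrightarrow>
     (\<exists>(br :: 's \<Rightarrow> 's \<Rightarrow> 's) (f :: 'n \<Rightarrow> 's).
        standard_einstein_solvmanifold br \<and>
        linear f \<and> inj f \<and> (\<forall>x y. f (\<mu> x y) = br (f x) (f y)) \<and>
        is_nilradical br (range f))"

text \<open>In the nine-element index type the numeral \<open>9\<close> denotes the same element as \<open>0\<close>, so the numerals
  \<open>1, ..., 9\<close> name the nine coordinates without repetition.\<close>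

abbreviation e :: "9 \<Rightarrow> real ^ 9" where
  "e i \<equiv> axis i 1"

definition mu_tilde :: "real \<Rightarrow> real ^ 9 \<Rightarrow> real ^ 9 \<Rightarrow> real ^ 9" where
  "mu_tilde t x y =
     (let w = (\<lambda>i j. x $ i * y $ j - x $ j * y $ i) in
        (w 5 4 + t * w 3 6 + w 1 2) *\<^sub>R e 7
      + (w 1 6 + t * w 5 2) *\<^sub>R e 8
      + (w 3 2 + t * w 1 4) *\<^sub>R e 9)"

lemma mu_tilde_basis:
  "mu_tilde t (e 5) (e 4) = e 7" "mu_tilde t (e 1) (e 6) = e 8" "mu_tilde t (e 3) (e 2) = e 9"
  "mu_tilde t (e 3) (e 6) = t *\<^sub>R e 7" "mu_tilde t (e 5) (e 2) = t *\<^sub>R e 8"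
  "mu_tilde t (e 1) (e 4) = t *\<^sub>R e 9" "mu_tilde t (e 1) (e 2) = e 7"
  by (simp_all add: mu_tilde_def Let_def axis_def)

lemma is_lie_bracket_mu_tilde: "is_lie_bracket (mu_tilde t)"
  unfolding is_lie_bracket_def bilinear_def linear_iff
  by (simp add: mu_tilde_def Let_def axis_def vec_eq_iff algebra_simps)

end

theory Submission
  imports Defs
begin

text \<open>
  Let \<open>s\<close> be the solvable algebra of a standard Einstein solvmanifold whose nilradical \<open>n\<close> is the given
  algebra, and let \<open>H\<close> be the vector dual to \<open>x \<mapsto> tr (ad x)\<close>.  Without \<open>[e 1, e 2] = e 7\<close> the bracket
  would be homogeneous for the operator \<open>E = diag(2, 2, -1, -1, -1, -1, -2, 1, 1)\<close>, and the group
  \<open>exp (r E)\<close> contracts the given bracket to the one without this term.  The Einstein equation says that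
  the bracket is critical for a functional that is convex along such a group; this forces the contraction to be
  trivial up to a change of basis, and an explicit computation shows that it is not.

  To make this direct, choose an orthonormal basis of \<open>s\<close> adapted to the flag \<open>e 7\<close>; \<open>e 7, e 8, e 9\<close>;
  \<open>e 3, \<dots>, e 9\<close>; \<open>n\<close>; \<open>s\<close>, and test the Einstein equation against operators that are scalar on each
  block (\<open>ricci_weighted_sum\<close>).  The result is an identity between structure constants, counted with their weights,
  and the diagonal of \<open>ad H\<close>.  It becomes effective because \<open>s\<close> preserves the flag: for \<open>t > 1\<close> each
  derivation of \<open>n\<close> is diagonal modulo maps into the centre (\<open>derivation_matrix_offdiagonal\<close>).  The same
  fact shows that \<open>n\<close> contains the derived algebra (\<open>derived_algebra_subset\<close>), so the orthogonal complement
  of \<open>n\<close> is abelian for a standard metric.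

  Two weights are used.  For the grading operator, \<open>1\<close> on \<open>n\<close> modulo its centre and \<open>2\<close> on the centre,
  the identity and the Cauchy-Schwarz inequality bound \<open>|H|\<^sup>2\<close> from both sides by \<open>- 8 c\<close>, where \<open>c\<close> is
  the Einstein constant.  Equality makes the symmetric part of \<open>ad H\<close> a multiple of the grading operator
  (\<open>mean_curvature_rigid\<close>) and kills the part of the action of the complement that maps
  \<open>n\<close> modulo its centre into the centre.  For
  \<open>E\<close>, which is trace free and orthogonal to the grading operator, the identity then reads: a sum of
  terms of one sign is zero (\<open>degeneration_rigid\<close>).  So there are \<open>x \<equiv> e 1\<close> and \<open>y \<equiv> e 2\<close> modulo
  \<open>e 3, \<dots>, e 9\<close> with \<open>[x, y] = 0\<close> whose brackets with \<open>e 3, \<dots>, e 6\<close> are orthogonal to \<open>e 7\<close>, and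
  such vectors do not exist (\<open>mu_tilde_no_graded_splitting\<close>).
\<close>

section \<open>Orthonormal bases of subspaces\<close>

definition orthonormal_basis_of :: "'a::euclidean_space set \<Rightarrow> 'a set \<Rightarrow> bool" where
  "orthonormal_basis_of U S \<longleftrightarrow>
     finite U \<and> span U = S \<and> (\<forall>u\<in>U. \<forall>v\<in>U. u \<bullet> v = (if u = v then 1 else 0))"

lemma orthonormal_basis_of_Basis: "orthonormal_basis_of Basis UNIV"
  by (auto simp: orthonormal_basis_of_def inner_Basis)

lemma orthonormal_basis_inner:
  "orthonormal_basis_of U S \<Longrightarrow> u \<in> U \<Longrightarrow> v \<in> U \<Longrightarrow> u \<bullet> v = (if u = v then 1 else 0)"
  by (auto simp: orthonormal_basis_of_def)

lemma orthonormal_basis_expand: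
  assumes U: "orthonormal_basis_of U S" and x: "x \<in> S"
  shows "x = (\<Sum>u\<in>U. (x \<bullet> u) *\<^sub>R u)"
proof -
  have fin: "finite U" and sp: "x \<in> span U"
    using U x by (auto simp: orthonormal_basis_of_def)
  obtain q where q: "x = (\<Sum>u\<in>U. q u *\<^sub>R u)"
    using sp span_finite[OF fin] by auto
  have "x \<bullet> v = q v" if "v \<in> U" for v
  proof -
    have "x \<bullet> v = (\<Sum>u\<in>U. q u * (u \<bullet> v))"
      by (simp add: q inner_sum_left)
    also have "\<dots> = (\<Sum>u\<in>U. if u = v then q u else 0)"
      using that by (intro sum.cong) (auto simp: orthonormal_basis_inner[OF U])
    finally show ?thesis using that fin by simp
  qed
  then have "(\<Sum>u\<in>U. (x \<bullet> u) *\<^sub>R u) = (\<Sum>u\<in>U. q u *\<^sub>R u)"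
    by (intro sum.cong) auto
  then show ?thesis by (simp add: q)
qed

lemma orthonormal_basis_parseval:
  assumes U: "orthonormal_basis_of U S" and x: "x \<in> S"
  shows "x \<bullet> y = (\<Sum>u\<in>U. (x \<bullet> u) * (y \<bullet> u))"
proof -
  have "x \<bullet> y = (\<Sum>u\<in>U. (x \<bullet> u) *\<^sub>R u) \<bullet> y"
    using orthonormal_basis_expand[OF U x] by simp
  also have "\<dots> = (\<Sum>u\<in>U. (x \<bullet> u) * (y \<bullet> u))"
    by (simp add: inner_sum_left inner_sum_right inner_commute[of _ y])
  finally show ?thesis .
qed

lemma orthonormal_basis_zeroI:
  assumes "orthonormal_basis_of U S" "x \<in> S" "\<And>u. u \<in> U \<Longrightarrow> x \<bullet> u = 0"
  shows "x = 0"
  using orthonormal_basis_expand[OF assms(1,2)] assms(3) by simp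

text \<open>Gram-Schmidt for a pair of nested subspaces: an orthonormal basis of the smaller one is completed by
  an orthonormal basis of its orthogonal complement inside the larger one.\<close>

lemma orthonormal_basis_extend:
  fixes S T :: "'a::euclidean_space set"
  assumes U: "orthonormal_basis_of U S" and ST: "S \<subseteq> T" and T: "subspace T"
  obtains V where "orthonormal_basis_of (U \<union> V) T" "U \<inter> V = {}"
proof -
  define C where "C = {x \<in> T. \<forall>u\<in>U. x \<bullet> u = 0}"
  have C: "subspace C"
    using T by (auto simp: C_def subspace_def inner_left_distrib)
  obtain V where V: "V \<subseteq> C" "pairwise orthogonal V" "\<And>x. x \<in> V \<Longrightarrow> norm x = 1"
      "independent V" "span V = C"
    using orthonormal_basis_subspace[OF C] by metis
  have finU: "finite U" and spU: "span U = S" using U by (auto simp: orthonormal_basis_of_def)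
  have finV: "finite V" using V(4) by (rule independent_imp_finite)
  have VV: "u \<bullet> v = (if u = v then 1 else 0)" if "u \<in> V" "v \<in> V" for u v
    using V(2,3) that by (auto simp: pairwise_def orthogonal_def dot_square_norm)
  have UV: "v \<bullet> u = 0" if "u \<in> U" "v \<in> V" for u v
    using V(1) that by (auto simp: C_def)
  have disj: "U \<inter> V = {}"
    using UV VV by fastforce
  have "span (U \<union> V) = T"
  proof
    show "span (U \<union> V) \<subseteq> T"
      using V(1) ST spU T span_superset[of U] by (intro span_minimal) (auto simp: C_def)
    show "T \<subseteq> span (U \<union> V)"
    proof
      fix x assume x: "x \<in> T"
      define p where "p = (\<Sum>u\<in>U. (x \<bullet> u) *\<^sub>R u)"
      have p: "p \<in> span U" unfolding p_def by (intro span_sum span_scale span_base)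
      have "(x - p) \<bullet> v = 0" if "v \<in> U" for v
      proof -
        have "p \<bullet> v = (\<Sum>u\<in>U. if u = v then x \<bullet> u else 0)"
          unfolding p_def inner_sum_left
          using that by (intro sum.cong) (auto simp: orthonormal_basis_inner[OF U])
        then show ?thesis using that finU by (simp add: inner_diff_left)
      qed
      then have "x - p \<in> span V"
        using x p spU ST T V(5) by (auto simp: C_def subspace_diff)
      then have "p + (x - p) \<in> span (U \<union> V)"
        using p by (intro span_add) (auto intro: set_mp[OF span_mono])
      then show "x \<in> span (U \<union> V)" by simp
    qed
  qed
  moreover have "u \<bullet> v = (if u = v then 1 else 0)" if "u \<in> U \<union> V" "v \<in> U \<union> V" for u v
    using that UV[of u v] UV[of v u] disj VV[of u v] orthonormal_basis_inner[OF U, of u v]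
    by (auto simp: inner_commute)
  ultimately have "orthonormal_basis_of (U \<union> V) T"
    using finU finV by (auto simp: orthonormal_basis_of_def)
  then show thesis using disj that by blast
qed

text \<open>The trace of an operator on an invariant subspace can be read off from any basis \<open>b\<close> with coordinate
  functionals \<open>\<epsilon>\<close>.  This is what connects the traces in the metric formulas, taken over orthonormal
  bases, with the entries of a derivation in the given basis of the nilradical.\<close>

lemma trace_orthonormal_basis:
  fixes L :: "'a::euclidean_space \<Rightarrow> 'a" and \<epsilon> :: "'i \<Rightarrow> 'a \<Rightarrow> real"
  assumes U: "orthonormal_basis_of U W"
    and L: "linear L" "\<And>x. x \<in> W \<Longrightarrow> L x \<in> W"
    and I: "finite I"
    and \<epsilon>: "\<And>i. i \<in> I \<Longrightarrow> linear (\<epsilon> i)"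
    and b: "\<And>i. i \<in> I \<Longrightarrow> b i \<in> W"
    and expand: "\<And>x. x \<in> W \<Longrightarrow> x = (\<Sum>i\<in>I. \<epsilon> i x *\<^sub>R b i)"
  shows "(\<Sum>u\<in>U. L u \<bullet> u) = (\<Sum>i\<in>I. \<epsilon> i (L (b i)))"
proof -
  have UW: "U \<subseteq> W" using U span_superset by (auto simp: orthonormal_basis_of_def)
  have "(\<Sum>u\<in>U. L u \<bullet> u) = (\<Sum>u\<in>U. \<Sum>i\<in>I. \<epsilon> i (L u) * (b i \<bullet> u))"
  proof (intro sum.cong refl)
    fix u assume "u \<in> U"
    then have "L u = (\<Sum>i\<in>I. \<epsilon> i (L u) *\<^sub>R b i)" using UW L(2) expand by blast
    then have "L u \<bullet> u = (\<Sum>i\<in>I. \<epsilon> i (L u) *\<^sub>R b i) \<bullet> u" by simp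
    then show "L u \<bullet> u = (\<Sum>i\<in>I. \<epsilon> i (L u) * (b i \<bullet> u))"
      by (simp add: inner_sum_left)
  qed
  also have "\<dots> = (\<Sum>i\<in>I. \<Sum>u\<in>U. \<epsilon> i (L u) * (b i \<bullet> u))"
    by (rule sum.swap)
  also have "\<dots> = (\<Sum>i\<in>I. \<epsilon> i (L (b i)))"
  proof (intro sum.cong refl)
    fix i assume i: "i \<in> I"
    have lin: "linear (\<lambda>x. \<epsilon> i (L x))"
      using linear_compose[OF L(1) \<epsilon>[OF i]] by (simp add: o_def)
    have "\<epsilon> i (L (\<Sum>u\<in>U. (b i \<bullet> u) *\<^sub>R u)) = (\<Sum>u\<in>U. (b i \<bullet> u) * \<epsilon> i (L u))"
      by (simp add: linear_sum[OF lin] linear_cmul[OF lin])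
    then show "(\<Sum>u\<in>U. \<epsilon> i (L u) * (b i \<bullet> u)) = \<epsilon> i (L (b i))"
      using orthonormal_basis_expand[OF U b[OF i]] by (simp add: mult.commute)
  qed
  finally show ?thesis .
qed

lemma trace_bilinear_form_orthonormal_basis:
  fixes B :: "'a::euclidean_space \<Rightarrow> 'a \<Rightarrow> real"
  assumes B: "bilinear B" and U: "orthonormal_basis_of U S" and V: "orthonormal_basis_of V S"
  shows "(\<Sum>u\<in>U. B u u) = (\<Sum>v\<in>V. B v v)"
proof -
  have S: "u \<in> S" if "u \<in> U" for u
    using U that span_base by (auto simp: orthonormal_basis_of_def)
  have S': "u \<in> S" if "u \<in> V" for u
    using V that span_base by (auto simp: orthonormal_basis_of_def)
  have "(\<Sum>u\<in>U. B u u) = (\<Sum>u\<in>U. \<Sum>v\<in>V. (u \<bullet> v) * B u v)"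
  proof (intro sum.cong refl)
    fix u assume "u \<in> U"
    then have u: "u = (\<Sum>v\<in>V. (u \<bullet> v) *\<^sub>R v)"
      by (intro orthonormal_basis_expand[OF V] S)
    have lin: "linear (B u)" using B by (simp add: bilinear_def)
    have "B u (\<Sum>v\<in>V. (u \<bullet> v) *\<^sub>R v) = (\<Sum>v\<in>V. (u \<bullet> v) * B u v)"
      by (simp add: linear_sum[OF lin] linear_cmul[OF lin])
    then show "B u u = (\<Sum>v\<in>V. (u \<bullet> v) * B u v)"
      by (simp flip: u)
  qed
  also have "\<dots> = (\<Sum>v\<in>V. \<Sum>u\<in>U. (u \<bullet> v) * B u v)"
    by (rule sum.swap)
  also have "\<dots> = (\<Sum>v\<in>V. B v v)"
  proof (intro sum.cong refl)
    fix v assume "v \<in> V"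
    then have v: "v = (\<Sum>u\<in>U. (v \<bullet> u) *\<^sub>R u)"
      by (intro orthonormal_basis_expand[OF U] S')
    have lin: "linear (\<lambda>u. B u v)" using B by (simp add: bilinear_def)
    have "B (\<Sum>u\<in>U. (v \<bullet> u) *\<^sub>R u) v = (\<Sum>u\<in>U. (u \<bullet> v) * B u v)"
      by (simp add: linear_sum[OF lin] linear_cmul[OF lin] inner_commute[of v])
    then show "(\<Sum>u\<in>U. (u \<bullet> v) * B u v) = B v v"
      by (simp flip: v)
  qed
  finally show ?thesis .
qed

section \<open>The Ricci curvature of a left invariant metric\<close>

text \<open>The vector dual to the linear form \<open>x \<mapsto> tr (ad x)\<close>; see \<open>mean_curvature_inner\<close>.\<close>

definition mean_curvature :: "('a::euclidean_space \<Rightarrow> 'a \<Rightarrow> 'a) \<Rightarrow> 'a" where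
  "mean_curvature br = (\<Sum>a\<in>Basis. (\<Sum>b\<in>Basis. br a b \<bullet> b) *\<^sub>R a)"

lemma linear_inner_fun: "linear L \<Longrightarrow> linear (\<lambda>x. L x \<bullet> z)"
  using linear_compose[of L "\<lambda>y. y \<bullet> z"]
  by (simp add: o_def bounded_linear.linear bounded_linear_inner_left)

locale skew_bracket =
  fixes br :: "'a::euclidean_space \<Rightarrow> 'a \<Rightarrow> 'a"
  assumes bil: "bilinear br" and skew0: "\<And>x. br x x = 0"
begin

lemma skew: "br x y = - br y x"
proof -
  have "br x y + br y x = br (x + y) (x + y)"
    by (simp add: bilinear_ladd[OF bil] bilinear_radd[OF bil] skew0[of x] skew0[of y])
  then show ?thesis using skew0[of "x + y"] by (simp add: eq_neg_iff_add_eq_0)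
qed

lemmas br_simps =
  bilinear_ladd[OF bil] bilinear_radd[OF bil] bilinear_lmul[OF bil] bilinear_rmul[OF bil]
  bilinear_lzero[OF bil] bilinear_rzero[OF bil] bilinear_lneg[OF bil] bilinear_rneg[OF bil]
  bilinear_lsub[OF bil] bilinear_rsub[OF bil]

lemma linear_br: "linear (br x)" "linear (\<lambda>x. br x y)"
  using bil by (auto simp: bilinear_def)

lemma levi_civita_inner:
  "levi_civita br x y \<bullet> z = (br x y \<bullet> z - br y z \<bullet> x + br z x \<bullet> y) / 2"
proof -
  define F where "F z = (br x y \<bullet> z - br y z \<bullet> x + br z x \<bullet> y) / 2" for z
  have F: "linear F"
    unfolding linear_iff F_def
    by (simp add: br_simps inner_left_distrib inner_right_distrib algebra_simps field_simps)
  have "F z = F (\<Sum>b\<in>Basis. (z \<bullet> b) *\<^sub>R b)" by (simp add: euclidean_representation)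
  also have "\<dots> = (\<Sum>b\<in>Basis. (z \<bullet> b) * F b)"
    by (simp add: linear_sum[OF F] linear_cmul[OF F])
  also have "\<dots> = levi_civita br x y \<bullet> z"
    by (simp add: levi_civita_def F_def inner_sum_left inner_commute[of z] mult.commute)
  finally show ?thesis by (simp add: F_def)
qed

lemma bilinear_levi_civita: "bilinear (levi_civita br)"
proof -
  have "levi_civita br (x + y) w = levi_civita br x w + levi_civita br y w"
    "levi_civita br w (x + y) = levi_civita br w x + levi_civita br w y"
    "levi_civita br (r *\<^sub>R x) w = r *\<^sub>R levi_civita br x w"
    "levi_civita br w (r *\<^sub>R x) = r *\<^sub>R levi_civita br w x" for x y w r
    by (rule vector_eq_ldot[THEN iffD1];
        simp add: levi_civita_inner inner_left_distrib inner_right_distrib br_simps field_simps inner_commute[of _ "levi_civita br _ _"] inner_commute[of _ "_ + _"] inner_commute[of _ "_ *\<^sub>R _"])+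
  then show ?thesis by (simp add: bilinear_def linear_iff)
qed

lemma mean_curvature_inner:
  assumes U: "orthonormal_basis_of U UNIV"
  shows "mean_curvature br \<bullet> x = (\<Sum>u\<in>U. br x u \<bullet> u)"
proof -
  have lin: "linear (\<lambda>a. \<Sum>b\<in>Basis. br a b \<bullet> b)"
    by (intro linear_compose_sum ballI linear_inner_fun linear_br)
  have "mean_curvature br \<bullet> x = (\<Sum>a\<in>Basis. (x \<bullet> a) * (\<Sum>b\<in>Basis. br a b \<bullet> b))"
    by (simp add: mean_curvature_def inner_sum_left inner_commute[of x] mult.commute)
  also have "\<dots> = (\<Sum>b\<in>Basis. br (\<Sum>a\<in>Basis. (x \<bullet> a) *\<^sub>R a) b \<bullet> b)"
    by (simp add: linear_sum[OF lin] linear_cmul[OF lin])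
  also have "\<dots> = (\<Sum>b\<in>Basis. br x b \<bullet> b)"
    by (simp add: euclidean_representation)
  also have "\<dots> = (\<Sum>u\<in>U. br x u \<bullet> u)"
    by (rule trace_bilinear_form_orthonormal_basis[OF _ orthonormal_basis_of_Basis U])
      (simp add: bilinear_def linear_iff br_simps inner_left_distrib inner_right_distrib)
  finally show ?thesis .
qed

text \<open>Let \<open>N u = \<nabla>\<^sub>u x\<close>.  Metric compatibility and torsion freeness turn \<open>Ric(x, x)\<close> into
  \<open>tr (N\<^sup>t N) + tr (N\<^sup>t L) + tr (N L)\<close> with \<open>L = ad x\<close>, up to the mean curvature term.  By the Koszul
  formula, \<open>N = K - S\<close> where \<open>S\<close> is the symmetric part of \<open>L\<close> and \<open>K\<close> is the skew operator with matrix
  \<open>[v, u] \<bullet> x / 2\<close>; the mixed terms cancel and \<open>|K|\<^sup>2 - |S|\<^sup>2\<close> is left.\<close>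

lemma ricci_orthonormal_basis:
  assumes U: "orthonormal_basis_of U UNIV"
  shows "ricci br x x =
      (\<Sum>u\<in>U. \<Sum>v\<in>U. ((br u v \<bullet> x) / 2)\<^sup>2 - ((br x u \<bullet> v + br x v \<bullet> u) / 2)\<^sup>2)
        - br (mean_curvature br) x \<bullet> x"
proof -
  define N where "N u = levi_civita br u x" for u
  have N: "N u \<bullet> v = (br v u \<bullet> x) / 2 - (br x u \<bullet> v + br x v \<bullet> u) / 2" for u v
    by (simp add: N_def levi_civita_inner skew[of u x] field_simps)
  have linN: "linear N"
    using bilinear_levi_civita by (simp add: N_def[abs_def] bilinear_def)
  have metric: "levi_civita br x y \<bullet> z = - (levi_civita br x z \<bullet> y)" for y z
    by (simp add: levi_civita_inner skew[of z x] skew[of y x] skew[of z y] field_simps)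
  have torsion: "levi_civita br x u = N u + br x u" for u
  proof -
    have "levi_civita br x u \<bullet> z = (N u + br x u) \<bullet> z" for z
      by (simp add: levi_civita_inner N_def inner_left_distrib skew[of u x] skew[of z x]
          skew[of z u] field_simps)
    then show ?thesis by (metis vector_eq_rdot)
  qed
  have bilR: "bilinear (\<lambda>u v. curvature br u x x \<bullet> v)"
  proof -
    note lc = bilinear_levi_civita
    have "curvature br (u + v) x x = curvature br u x x + curvature br v x x"
      "curvature br (r *\<^sub>R u) x x = r *\<^sub>R curvature br u x x" for u v r
      by (simp_all add: curvature_def br_simps bilinear_ladd[OF lc] bilinear_radd[OF lc]
          bilinear_lmul[OF lc] bilinear_rmul[OF lc] scaleR_diff_right)
    then show ?thesis
      by (simp add: bilinear_def linear_iff inner_left_distrib inner_right_distrib)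
  qed
  have "ricci br x x = (\<Sum>u\<in>U. curvature br u x x \<bullet> u)"
    unfolding ricci_def
    by (rule trace_bilinear_form_orthonormal_basis[OF bilR orthonormal_basis_of_Basis U])
  also have "\<dots> = (\<Sum>u\<in>U. (N u \<bullet> N u + N u \<bullet> br x u + N (br x u) \<bullet> u)
      - br (levi_civita br x x) u \<bullet> u)"
  proof (intro sum.cong refl)
    fix u
    have 1: "levi_civita br u y \<bullet> u = - (br y u \<bullet> u)" for y
      by (simp add: levi_civita_inner skew0 skew[of u y])
    have 2: "levi_civita br x (levi_civita br u x) \<bullet> u = - (N u \<bullet> N u + N u \<bullet> br x u)"
    proof -
      have "levi_civita br x (N u) \<bullet> u = - (levi_civita br x u \<bullet> N u)" by (rule metric)
      then show ?thesis
        unfolding torsion inner_left_distrib N_def by (simp add: inner_commute)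
    qed
    have 3: "levi_civita br (br u x) x = - N (br x u)"
      by (simp add: N_def[symmetric] skew[of u x] linear_neg[OF linN])
    show "curvature br u x x \<bullet> u = (N u \<bullet> N u + N u \<bullet> br x u + N (br x u) \<bullet> u)
      - br (levi_civita br x x) u \<bullet> u"
      unfolding curvature_def inner_diff_left by (simp add: 1 2 3)
  qed
  also have "\<dots> = (\<Sum>u\<in>U. N u \<bullet> N u + N u \<bullet> br x u + N (br x u) \<bullet> u)
      - mean_curvature br \<bullet> levi_civita br x x"
    by (simp add: sum_subtractf mean_curvature_inner[OF U])
  also have "mean_curvature br \<bullet> levi_civita br x x = br (mean_curvature br) x \<bullet> x"
    by (simp add: inner_commute[of _ "levi_civita br _ _"] levi_civita_inner skew0
        skew[of x "mean_curvature br"])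
  also have "(\<Sum>u\<in>U. N u \<bullet> N u + N u \<bullet> br x u + N (br x u) \<bullet> u)
    = (\<Sum>u\<in>U. \<Sum>v\<in>U. (N u \<bullet> v)\<^sup>2 + (N u \<bullet> v) * (br x u \<bullet> v) + (br x u \<bullet> v) * (N v \<bullet> u))"
  proof (intro sum.cong refl)
    fix u
    have "N u \<bullet> N u = (\<Sum>v\<in>U. (N u \<bullet> v) * (N u \<bullet> v))"
      "N u \<bullet> br x u = (\<Sum>v\<in>U. (N u \<bullet> v) * (br x u \<bullet> v))"
      by (rule orthonormal_basis_parseval[OF U]; simp)+
    moreover have "N (br x u) \<bullet> u = (\<Sum>v\<in>U. (br x u \<bullet> v) * (N v \<bullet> u))"
    proof -
      have "N (br x u) = N (\<Sum>v\<in>U. (br x u \<bullet> v) *\<^sub>R v)"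
        by (rule arg_cong[where f = N], rule orthonormal_basis_expand[OF U]) simp
      then show ?thesis
        by (simp add: linear_sum[OF linN] linear_cmul[OF linN] inner_sum_left)
    qed
    ultimately show "N u \<bullet> N u + N u \<bullet> br x u + N (br x u) \<bullet> u = (\<Sum>v\<in>U. (N u \<bullet> v)\<^sup>2
        + (N u \<bullet> v) * (br x u \<bullet> v) + (br x u \<bullet> v) * (N v \<bullet> u))"
      by (simp add: sum.distrib power2_eq_square)
  qed
  also have "\<dots> = (\<Sum>u\<in>U. \<Sum>v\<in>U. ((br u v \<bullet> x) / 2)\<^sup>2 - ((br x u \<bullet> v + br x v \<bullet> u) / 2)\<^sup>2)"
    (is "(\<Sum>u\<in>U. \<Sum>v\<in>U. ?P u v) = (\<Sum>u\<in>U. \<Sum>v\<in>U. ?Q u v)")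
  proof -
    \<comment> \<open>The summands agree only after symmetrising in \<open>u\<close> and \<open>v\<close>: this is where the products of
      symmetric and skew operators drop out.\<close>
    have sym: "?P u v + ?P v u = ?Q u v + ?Q v u" for u v
      unfolding N by (simp add: skew[of v u] power2_eq_square field_simps)
    have dbl: "2 * (\<Sum>u\<in>U. \<Sum>v\<in>U. G u v) = (\<Sum>u\<in>U. \<Sum>v\<in>U. G u v + G v u)"
      for G :: "'a \<Rightarrow> 'a \<Rightarrow> real"
      using sum.swap[of G U U] by (simp add: sum.distrib)
    have "2 * (\<Sum>u\<in>U. \<Sum>v\<in>U. ?P u v) = 2 * (\<Sum>u\<in>U. \<Sum>v\<in>U. ?Q u v)"
      unfolding dbl sym ..
    then show ?thesis by simp
  qed
  finally show ?thesis .
qed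

text \<open>The Einstein equation tested against the symmetric operator that has the vectors of \<open>U\<close> as eigenvectors
  and the weights \<open>\<omega>\<close> as eigenvalues.  The left hand side is the inner product of the bracket with its
  variation under that operator, so its sign is visible as soon as the weights of the nonzero structure
  constants are known.  The Ricci curvature also contains the Killing form, whose sign is not
  under control; it drops out when \<open>\<omega>\<close> vanishes wherever \<open>tr ((ad u)\<^sup>2) \<noteq> 0\<close>.\<close>

lemma ricci_weighted_sum:
  assumes U: "orthonormal_basis_of U UNIV"
    and einstein: "\<And>u. u \<in> U \<Longrightarrow> ricci br u u = c"
    and killing: "\<And>u. u \<in> U \<Longrightarrow> \<omega> u \<noteq> 0 \<Longrightarrow> (\<Sum>v\<in>U. \<Sum>w\<in>U. (br u v \<bullet> w) * (br u w \<bullet> v)) = 0"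
  shows "(\<Sum>u\<in>U. \<Sum>v\<in>U. \<Sum>w\<in>U. (\<omega> w - \<omega> u - \<omega> v) * (br u v \<bullet> w)\<^sup>2)
    = 4 * ((\<Sum>u\<in>U. \<omega> u * (br (mean_curvature br) u \<bullet> u)) + c * (\<Sum>u\<in>U. \<omega> u))"
proof -
  define a where "a u v w = (br u v \<bullet> w)\<^sup>2" for u v w
  have a_skew: "a u v w = a v u w" for u v w
    by (simp add: a_def skew[of u v])
  have ric: "\<omega> u * c = (\<Sum>v\<in>U. \<Sum>w\<in>U. \<omega> u * a v w u) / 4 - (\<Sum>v\<in>U. \<Sum>w\<in>U. \<omega> u * a u v w) / 2
      - \<omega> u * (br (mean_curvature br) u \<bullet> u)" if u: "u \<in> U" for u
  proof (cases "\<omega> u = 0")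
    case False
    have "c = (\<Sum>v\<in>U. \<Sum>w\<in>U. ((br v w \<bullet> u) / 2)\<^sup>2 - ((br u v \<bullet> w + br u w \<bullet> v) / 2)\<^sup>2)
        - br (mean_curvature br) u \<bullet> u"
      unfolding einstein[OF u, symmetric] by (rule ricci_orthonormal_basis[OF U])
    also have "(\<Sum>v\<in>U. \<Sum>w\<in>U. ((br v w \<bullet> u) / 2)\<^sup>2 - ((br u v \<bullet> w + br u w \<bullet> v) / 2)\<^sup>2)
      = (\<Sum>v\<in>U. \<Sum>w\<in>U. a v w u / 4 - a u v w / 4 - a u w v / 4
            - (br u v \<bullet> w) * (br u w \<bullet> v) / 2)"
      by (intro sum.cong refl) (simp add: a_def power2_eq_square field_simps)
    also have "\<dots> = (\<Sum>v\<in>U. \<Sum>w\<in>U. a v w u) / 4 - (\<Sum>v\<in>U. \<Sum>w\<in>U. a u v w) / 4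
        - (\<Sum>v\<in>U. \<Sum>w\<in>U. a u w v) / 4 - (\<Sum>v\<in>U. \<Sum>w\<in>U. (br u v \<bullet> w) * (br u w \<bullet> v)) / 2"
      by (simp add: sum_subtractf sum_divide_distrib)
    also have "(\<Sum>v\<in>U. \<Sum>w\<in>U. a u w v) = (\<Sum>v\<in>U. \<Sum>w\<in>U. a u v w)"
      by (rule sum.swap)
    finally have c: "c = (\<Sum>v\<in>U. \<Sum>w\<in>U. a v w u) / 4 - (\<Sum>v\<in>U. \<Sum>w\<in>U. a u v w) / 2
        - br (mean_curvature br) u \<bullet> u"
      unfolding killing[OF u False] by linarith
    have "\<omega> u * c = \<omega> u * ((\<Sum>v\<in>U. \<Sum>w\<in>U. a v w u) / 4 - (\<Sum>v\<in>U. \<Sum>w\<in>U. a u v w) / 2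
        - br (mean_curvature br) u \<bullet> u)"
      by (rule arg_cong[OF c])
    then show ?thesis
      by (simp add: right_diff_distrib sum_distrib_left)
  qed simp
  have 1: "(\<Sum>u\<in>U. \<Sum>v\<in>U. \<Sum>w\<in>U. \<omega> w * a u v w) = (\<Sum>u\<in>U. \<Sum>v\<in>U. \<Sum>w\<in>U. \<omega> u * a v w u)"
  proof -
    have "(\<Sum>u\<in>U. \<Sum>v\<in>U. \<Sum>w\<in>U. \<omega> w * a u v w) = (\<Sum>u\<in>U. \<Sum>w\<in>U. \<Sum>v\<in>U. \<omega> w * a u v w)"
      by (intro sum.cong refl sum.swap)
    also have "\<dots> = (\<Sum>w\<in>U. \<Sum>u\<in>U. \<Sum>v\<in>U. \<omega> w * a u v w)"
      by (rule sum.swap)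
    finally show ?thesis .
  qed
  have 2: "(\<Sum>u\<in>U. \<Sum>v\<in>U. \<Sum>w\<in>U. \<omega> v * a u v w) = (\<Sum>u\<in>U. \<Sum>v\<in>U. \<Sum>w\<in>U. \<omega> u * a u v w)"
    by (subst sum.swap) (simp add: a_skew)
  have "(\<Sum>u\<in>U. \<Sum>v\<in>U. \<Sum>w\<in>U. (\<omega> w - \<omega> u - \<omega> v) * a u v w)
     = (\<Sum>u\<in>U. \<Sum>v\<in>U. \<Sum>w\<in>U. \<omega> u * a v w u) - 2 * (\<Sum>u\<in>U. \<Sum>v\<in>U. \<Sum>w\<in>U. \<omega> u * a u v w)"
    by (simp add: left_diff_distrib sum_subtractf 1 2)
  also have "\<dots> = 4 * (\<Sum>u\<in>U. \<omega> u * c + \<omega> u * (br (mean_curvature br) u \<bullet> u))"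
  proof -
    have "(\<Sum>u\<in>U. \<omega> u * c + \<omega> u * (br (mean_curvature br) u \<bullet> u))
        = (\<Sum>u\<in>U. (\<Sum>v\<in>U. \<Sum>w\<in>U. \<omega> u * a v w u) / 4 - (\<Sum>v\<in>U. \<Sum>w\<in>U. \<omega> u * a u v w) / 2)"
      by (intro sum.cong refl) (simp add: ric)
    then show ?thesis by (simp add: sum_subtractf sum_divide_distrib[symmetric])
  qed
  finally show ?thesis
    by (simp add: a_def sum.distrib sum_distrib_left mult.commute[of _ c])
qed

end

section \<open>Derivations of the nine-dimensional algebra\<close>

definition is_derivation :: "('a::real_vector \<Rightarrow> 'a \<Rightarrow> 'a) \<Rightarrow> ('a \<Rightarrow> 'a) \<Rightarrow> bool" where
  "is_derivation \<mu> D \<longleftrightarrow> linear D \<and> (\<forall>x y. D (\<mu> x y) = \<mu> (D x) y + \<mu> x (D y))"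

definition coordinate_subspace :: "'n::finite set \<Rightarrow> (real ^ 'n) set" where
  "coordinate_subspace I = {x. \<forall>i. i \<notin> I \<longrightarrow> x $ i = 0}"

lemma subspace_coordinate_subspace: "subspace (coordinate_subspace I)"
  by (auto simp: coordinate_subspace_def subspace_def)

lemma axis_in_coordinate_subspace: "i \<in> I \<Longrightarrow> axis i c \<in> coordinate_subspace I"
  by (auto simp: coordinate_subspace_def axis_def)

lemma axis_nth_if: "axis i c $ j = (if j = i then c else 0)"
  by (simp add: axis_def)

lemma vec_sum_axis:
  fixes x :: "real ^ 'n::finite"
  shows "x = (\<Sum>i\<in>UNIV. (x $ i) *\<^sub>R axis i 1)"
  by (simp add: vec_eq_iff axis_def if_distrib cong: if_cong)

lemma coordinate_subspace_sum_axis: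
  assumes "x \<in> coordinate_subspace I"
  shows "x = (\<Sum>i\<in>I. (x $ i) *\<^sub>R axis i 1)"
proof -
  have "(\<Sum>i\<in>UNIV. (x $ i) *\<^sub>R axis i (1::real)) = (\<Sum>i\<in>I. (x $ i) *\<^sub>R axis i 1)"
    using assms by (intro sum.mono_neutral_right) (auto simp: coordinate_subspace_def)
  then show ?thesis using vec_sum_axis[of x] by (rule trans[OF _ , rotated])
qed

lemma UNIV_9: "(UNIV :: 9 set) = {1, 2, 3, 4, 5, 6, 7, 8, 9}"
  by (rule sym, rule card_subset_eq) simp_all

lemma forall_9: "(\<forall>i::9. P i) \<longleftrightarrow>
    P 1 \<and> P 2 \<and> P 3 \<and> P 4 \<and> P 5 \<and> P 6 \<and> P 7 \<and> P 8 \<and> P 9"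
proof -
  have "(\<forall>i::9. P i) \<longleftrightarrow> (\<forall>i\<in>{1, 2, 3, 4, 5, 6, 7, 8, 9}. P i)"
    by (metis UNIV_9 UNIV_I)
  then show ?thesis by simp
qed

lemma mu_tilde_nth:
  "mu_tilde t x y $ i =
    (if i = 7 then x$5 * y$4 - x$4 * y$5 + t * (x$3 * y$6 - x$6 * y$3) + (x$1 * y$2 - x$2 * y$1)
     else if i = 8 then x$1 * y$6 - x$6 * y$1 + t * (x$5 * y$2 - x$2 * y$5)
     else if i = 9 then x$3 * y$2 - x$2 * y$3 + t * (x$1 * y$4 - x$4 * y$1)
     else 0)"
  by (simp add: mu_tilde_def Let_def axis_def)

text \<open>Comparing coefficients in the derivation rule for pairs of basis vectors gives linear equations for the
  matrix of \<open>D\<close>.  Most unknowns occur in cycles of length three, \<open>a = \<plusminus>t b\<close>, \<open>b = t c\<close>, \<open>c = t a\<close>, which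
  force \<open>(1 \<minusplus> t\<^sup>3) a = 0\<close>.  At \<open>t = 1\<close> the cycles with the plus sign do have solutions, and there
  further derivations appear.  Hence for \<open>t > 1\<close> only the diagonal and the maps from
  \<open>e 1, \<dots>, e 6\<close> to the centre survive.\<close>

lemma derivation_matrix_offdiagonal:
  fixes t :: real
  assumes t: "1 < t" and D: "is_derivation (mu_tilde t) D"
    and ij: "i \<noteq> j" "\<not> (i \<in> {7, 8, 9} \<and> j \<notin> {7, 8, 9})"
  shows "D (e j) $ i = 0"
proof -
  define d where "d i j = D (e j) $ i" for i j
  have lin: "linear D" and der: "D (mu_tilde t x y) = mu_tilde t (D x) y + mu_tilde t x (D y)" for x y
    using D by (auto simp: is_derivation_def)
  have ent: "(D (mu_tilde t (e a) (e b))) $ k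
      = mu_tilde t (D (e a)) (e b) $ k + mu_tilde t (e a) (D (e b)) $ k" for a b k
    by (simp add: der)
  have t0: "t \<noteq> 0" "1 + t ^ 3 \<noteq> 0" "1 - t ^ 3 \<noteq> 0"
    using t one_less_power[of t 3] by (simp_all add: add_pos_pos less_imp_neq[symmetric])
  have e0: "mu_tilde t x (e m) = 0" if "m \<in> {7, 8, 9}" for x m
    using that by (auto simp: vec_eq_iff mu_tilde_nth axis_def)
  have D0: "D 0 = 0" using linear_0[OF lin] .
  have Dr: "D (r *\<^sub>R x) = r *\<^sub>R D x" for r x using linear_cmul[OF lin] .
  have br0: "mu_tilde t (e 1) (e 3) = 0" "mu_tilde t (e 1) (e 5) = 0" "mu_tilde t (e 3) (e 5) = 0"
    "mu_tilde t (e 2) (e 4) = 0" "mu_tilde t (e 2) (e 6) = 0" "mu_tilde t (e 4) (e 6) = 0"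
    "mu_tilde t (e 3) (e 4) = 0" "mu_tilde t (e 5) (e 6) = 0"
    by (simp_all add: vec_eq_iff mu_tilde_nth axis_def)
  \<comment> \<open>A derivation maps the centre, spanned by \<open>e 7\<close>, \<open>e 8\<close>, \<open>e 9\<close>, into itself.\<close>
  have z: "d i m = 0" if "m \<in> {7, 8, 9}" "i \<notin> {7, 8, 9}" for i m
  proof -
    have "mu_tilde t (e a) (D (e m)) $ k = 0" for a k
      using ent[of a m k] that(1) by (simp add: e0 D0)
    from this[of 2 7] this[of 1 7] this[of 2 9] this[of 1 9] this[of 4 7] this[of 1 8]
    have "\<forall>i. i \<notin> {7, 8, 9} \<longrightarrow> d i m = 0"
      unfolding forall_9 using t by (simp add: mu_tilde_nth axis_nth_if d_def)
    then show ?thesis using that by blast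
  qed
  note S = mu_tilde_basis br0 D0 Dr mu_tilde_nth axis_nth_if d_def
  have e21a: "d 2 1 = t * d 4 3" using ent[of 1 3 9] t0 by (simp add: S)
  have e65: "d 6 5 = t * d 2 1" using ent[of 1 5 8] t0 by (simp add: S)
  have e43: "d 4 3 = t * d 6 5" using ent[of 3 5 7] t0 by (simp add: S)
  have e34: "d 3 4 = t * d 1 2" using ent[of 2 4 9] t0 by (simp add: S)
  have e12a: "d 1 2 = t * d 5 6" using ent[of 2 6 8] t0 by (simp add: S)
  have e56: "d 5 6 = t * d 3 4" using ent[of 4 6 7] t0 by (simp add: S)
  have e24a: "d 2 4 = - t * d 1 3" using ent[of 3 4 9] t0 by (simp add: S)
  have e13: "d 1 3 = t * d 8 7" using ent[of 3 6 8] t0 by (simp add: S)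
  have e87: "d 8 7 = t * d 2 4" using ent[of 5 4 8] t0 by (simp add: S)
  have e46a: "d 4 6 = - t * d 3 5" using ent[of 5 6 7] t0 by (simp add: S)
  have e35: "d 3 5 = t * d 9 8" using ent[of 5 2 9] t0 by (simp add: S)
  have e98: "d 9 8 = t * d 4 6" using ent[of 1 6 9] t0 by (simp add: S)
  have e15a: "d 1 5 = - t * d 2 6" using ent[of 5 6 8] t0 by (simp add: S)
  have e26: "d 2 6 = t * d 9 7" using ent[of 3 6 9] t0 by (simp add: S)
  have e97: "d 9 7 = t * d 1 5" using ent[of 5 4 9] t0 by (simp add: S)
  have e53a: "d 5 3 = - t * d 6 4" using ent[of 3 4 7] t0 by (simp add: S)
  have e64: "d 6 4 = t * d 8 9" using ent[of 1 4 8] t0 by (simp add: S)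
  have e89: "d 8 9 = t * d 5 3" using ent[of 3 2 8] t0 by (simp add: S)
  have e62a: "d 8 7 = d 6 2 + t * d 5 1" using ent[of 1 2 8] t0 by (simp add: S)
  have e62b: "d 2 4 + d 5 1 = t * d 7 9" using ent[of 1 4 7] t0 by (simp add: S)
  have e62c: "d 7 9 = d 1 3 + t * d 6 2" using ent[of 3 2 7] t0 by (simp add: S)
  have e31a: "d 9 7 = d 3 1 + t * d 4 2" using ent[of 1 2 9] t0 by (simp add: S)
  have e31b: "d 2 6 = d 7 8 - t * d 3 1" using ent[of 1 6 7] t0 by (simp add: S)
  have e31c: "d 1 5 + d 4 2 = t * d 7 8" using ent[of 5 2 7] t0 by (simp add: S)
  have e63: "d 6 3 = 0" using ent[of 1 3 8] t0 by (simp add: S)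
  have e41: "d 2 5 = d 4 1" using ent[of 1 5 7] t0 by (simp add: S)
  have e25: "d 2 5 = 0" using ent[of 3 5 9] t0 by (simp add: S)
  have e45: "d 4 5 = 0" using ent[of 1 5 9] t0 by (simp add: S)
  have e52: "d 1 4 = d 5 2" using ent[of 2 4 7] t0 by (simp add: S)
  have e14: "d 1 4 = 0" using ent[of 4 6 8] t0 by (simp add: S)
  have e54: "d 5 4 = 0" using ent[of 2 4 8] t0 by (simp add: S)
  have e16: "d 1 6 = 0" using ent[of 4 6 9] t0 by (simp add: S)
  have e32: "d 1 6 = t * d 3 2" using ent[of 2 6 7] t0 by (simp add: S)
  have e36: "d 3 6 = 0" using ent[of 2 6 9] t0 by (simp add: S)
  have e23: "d 2 3 = 0" using ent[of 3 5 8] t0 by (simp add: S)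
  have e61: "d 2 3 = t * d 6 1" using ent[of 1 3 7] t0 by (simp add: S)
  have cyc: "a = 0 \<and> b = 0 \<and> c = 0" if "a = t * b" "b = t * c" "c = t * a" for a b c
  proof -
    have "t * (t * (t * a)) = a" by (simp flip: that)
    moreover have "a * (1 - t ^ 3) = a - t * (t * (t * a))"
      by (simp add: algebra_simps power3_eq_cube)
    ultimately have "a * (1 - t ^ 3) = 0" by (simp only: diff_self)
    then have a: "a = 0" using t0 by simp
    have c: "c = 0" unfolding that(3) a by simp
    have "b = 0" unfolding that(2) c by simp
    with a c show ?thesis by blast
  qed
  have anticyc: "a = 0 \<and> b = 0 \<and> c = 0" if "a = - t * b" "b = t * c" "c = t * a" for a b c
  proof -
    have tb: "t * b = - a" using that(1) by simp
    have "t * (t * (t * a)) = - a" by (simp add: tb flip: that(2,3))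
    moreover have "a * (1 + t ^ 3) = a + t * (t * (t * a))"
      by (simp add: algebra_simps power3_eq_cube)
    ultimately have "a * (1 + t ^ 3) = 0" by (simp only: right_minus)
    then have a: "a = 0" using t0 by simp
    have c: "c = 0" unfolding that(3) a by simp
    have "b = 0" unfolding that(2) c by simp
    with a c show ?thesis by blast
  qed
  note c1 = cyc[OF e21a e43 e65] cyc[OF e34 e12a e56]
    anticyc[OF e24a e13 e87] anticyc[OF e46a e35 e98] anticyc[OF e15a e26 e97]
    anticyc[OF e53a e64 e89]
  have c2: "d 6 2 = 0 \<and> d 5 1 = 0 \<and> d 7 9 = 0"
    by (rule anticyc) (use e62a e62b e62c c1 in simp_all)
  have c3: "d 3 1 = 0 \<and> d 4 2 = 0 \<and> d 7 8 = 0"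
    by (rule anticyc) (use e31a e31b e31c c1 in simp_all)
  have c4: "d 4 1 = 0" "d 5 2 = 0" "d 3 2 = 0" "d 6 1 = 0"
    using e41 e25 e52 e14 e16 e32 e23 e61 t0 by simp_all
  have "\<forall>i j. i \<noteq> j \<longrightarrow> \<not> (i \<in> {7, 8, 9} \<and> j \<notin> {7, 8, 9}) \<longrightarrow> d i j = 0"
    unfolding forall_9 using c1 c2 c3 c4 e63 e25 e45 e14 e54 e16 e36 e23 by (simp add: z)
  then have "d i j = 0" using ij by blast
  then show ?thesis by (simp add: d_def)
qed

text \<open>Each of the central vectors \<open>e 7\<close>, \<open>e 8\<close>, \<open>e 9\<close> is the bracket of one of the disjoint pairs
  \<open>e 5, e 4\<close> and \<open>e 1, e 6\<close> and \<open>e 3, e 2\<close>, so the trace on the centre equals the trace on the quotient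
  by the centre.\<close>

lemma derivation_trace:
  assumes D: "is_derivation (mu_tilde t) D"
  shows "(\<Sum>i\<in>UNIV. D (e i) $ i) = 2 * (\<Sum>i\<in>{7, 8, 9}. D (e i) $ i)"
proof -
  have ent: "(D (mu_tilde t (e a) (e b))) $ k
      = mu_tilde t (D (e a)) (e b) $ k + mu_tilde t (e a) (D (e b)) $ k" for a b k
    using D by (simp add: is_derivation_def)
  note S = mu_tilde_basis mu_tilde_nth axis_nth_if
  have "D (e 7) $ 7 = D (e 5) $ 5 + D (e 4) $ 4" "D (e 8) $ 8 = D (e 1) $ 1 + D (e 6) $ 6"
    "D (e 9) $ 9 = D (e 3) $ 3 + D (e 2) $ 2"
    using ent[of 5 4 7] ent[of 1 6 8] ent[of 3 2 9] by (simp_all add: S)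
  moreover have "(\<Sum>i\<in>UNIV. f i) = f 1 + f 2 + f 3 + f 4 + f 5 + f 6 + f 7 + f 8 + f 9"
    for f :: "9 \<Rightarrow> real"
    unfolding UNIV_9 by simp
  moreover have "(\<Sum>i\<in>{7, 8, 9}. f i) = f 7 + f 8 + f 9" for f :: "9 \<Rightarrow> real"
    by simp
  ultimately show ?thesis by (smt (verit))
qed

lemma derivation_nth_quotient:
  fixes t :: real
  assumes t: "1 < t" and D: "is_derivation (mu_tilde t) D" and i: "i \<notin> {7, 8, 9}"
  shows "D x $ i = x $ i * (D (e i) $ i)"
proof -
  have lin: "linear D" using D by (auto simp: is_derivation_def)
  have "D x = D (\<Sum>j\<in>UNIV. (x $ j) *\<^sub>R e j)" by (rule arg_cong[OF vec_sum_axis])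
  then have "D x $ i = (\<Sum>j\<in>UNIV. x $ j * (D (e j) $ i))"
    by (simp add: linear_sum[OF lin] linear_cmul[OF lin])
  also have "\<dots> = (\<Sum>j\<in>UNIV. if j = i then x $ i * (D (e i) $ i) else 0)"
  proof (intro sum.cong refl)
    fix j
    have "i \<noteq> j \<Longrightarrow> D (e j) $ i = 0"
      by (rule derivation_matrix_offdiagonal[OF t D]) (use i in blast)+
    then show "x $ j * (D (e j) $ i) = (if j = i then x $ i * (D (e i) $ i) else 0)"
      by (cases "i = j") simp_all
  qed
  finally show ?thesis by simp
qed

lemma derivation_nth_centre:
  fixes t :: real
  assumes t: "1 < t" and D: "is_derivation (mu_tilde t) D" and x: "x \<in> coordinate_subspace {7, 8, 9}"
  shows "D x $ i = x $ i * (D (e i) $ i)"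
proof -
  have lin: "linear D" using D by (auto simp: is_derivation_def)
  have "D x = D (\<Sum>j\<in>UNIV. (x $ j) *\<^sub>R e j)" by (rule arg_cong[OF vec_sum_axis])
  then have "D x $ i = (\<Sum>j\<in>UNIV. x $ j * (D (e j) $ i))"
    by (simp add: linear_sum[OF lin] linear_cmul[OF lin])
  also have "\<dots> = (\<Sum>j\<in>UNIV. if j = i then x $ i * (D (e i) $ i) else 0)"
  proof (intro sum.cong refl)
    fix j
    show "x $ j * (D (e j) $ i) = (if j = i then x $ i * (D (e i) $ i) else 0)"
    proof (cases "i = j")
      case False
      then have "D (e j) $ i = 0 \<or> x $ j = 0"
        using derivation_matrix_offdiagonal[OF t D False] x
        by (cases "j \<in> {7, 8, 9}") (unfold coordinate_subspace_def, blast+)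
      with False show ?thesis by auto
    qed simp
  qed
  finally show ?thesis by simp
qed

lemma derivation_preserves_coordinate_subspace:
  fixes t :: real
  assumes t: "1 < t" and D: "is_derivation (mu_tilde t) D"
    and I: "I \<subseteq> {7, 8, 9} \<or> {7, 8, 9} \<subseteq> I" and x: "x \<in> coordinate_subspace I"
  shows "D x \<in> coordinate_subspace I"
proof -
  have "D x $ i = 0" if i: "i \<notin> I" for i
  proof -
    have xi: "x $ i = 0" using x i by (simp add: coordinate_subspace_def)
    show ?thesis
    proof (cases "I \<subseteq> {7, 8, 9}")
      case True
      then have "x \<in> coordinate_subspace {7, 8, 9}"
        using x by (auto simp: coordinate_subspace_def)
      then show ?thesis using derivation_nth_centre[OF t D] xi by simp
    next
      case False
      then have "i \<notin> {7, 8, 9}" using I i by blast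
      then show ?thesis using derivation_nth_quotient[OF t D, of i x] xi by simp
    qed
  qed
  then show ?thesis by (simp add: coordinate_subspace_def)
qed

text \<open>Suppose that vectors \<open>x \<equiv> e 1\<close> and \<open>y \<equiv> e 2\<close>, modulo the span of \<open>e 3, \<dots>, e 9\<close>, commute and that
  their brackets with \<open>e 3, \<dots>, e 6\<close> lie in a plane of the centre complementary to \<open>e 7\<close>, the kernel of \<open>l\<close>
  there.  The second condition determines the coordinates \<open>3, \<dots>, 6\<close> of \<open>x\<close> and \<open>y\<close> in terms of \<open>l\<close>, the
  components of \<open>[x, y] = 0\<close> along \<open>e 8\<close> and \<open>e 9\<close> then make all of them vanish, and the component
  along \<open>e 7\<close> becomes \<open>[e 1, e 2] = e 7\<close>.  So the bracket \<open>[e 1, e 2] = e 7\<close> cannot be removed by a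
  change of basis that respects the flag.\<close>

lemma mu_tilde_no_graded_splitting:
  fixes t :: real and l :: "real ^ 9 \<Rightarrow> real"
  assumes t: "1 < t" and l: "linear l" "l (e 7) \<noteq> 0"
    and x: "x $ 1 = 1" "x $ 2 = 0" and y: "y $ 1 = 0" "y $ 2 = 1"
    and xy: "mu_tilde t x y = 0"
    and lx: "\<And>i. i \<in> {3, 4, 5, 6} \<Longrightarrow> l (mu_tilde t x (e i)) = 0"
    and ly: "\<And>i. i \<in> {3, 4, 5, 6} \<Longrightarrow> l (mu_tilde t y (e i)) = 0"
  shows False
proof -
  define a b c where "a = l (e 7)" and "b = l (e 8)" and "c = l (e 9)"
  have l_mu: "l (mu_tilde t u v) =
      (mu_tilde t u v $ 7) * a + (mu_tilde t u v $ 8) * b + (mu_tilde t u v $ 9) * c" for u v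
  proof -
    have "mu_tilde t u v = (mu_tilde t u v $ 7) *\<^sub>R e 7 + (mu_tilde t u v $ 8) *\<^sub>R e 8
        + (mu_tilde t u v $ 9) *\<^sub>R e 9"
      by (simp add: vec_eq_iff mu_tilde_nth axis_nth_if)
    then have "l (mu_tilde t u v) = l ((mu_tilde t u v $ 7) *\<^sub>R e 7 + (mu_tilde t u v $ 8) *\<^sub>R e 8
        + (mu_tilde t u v $ 9) *\<^sub>R e 9)"
      by (rule arg_cong)
    then show ?thesis
      by (simp only: linear_add[OF l(1)] linear_cmul[OF l(1)] a_def b_def c_def real_scaleR_def)
  qed
  note S = l_mu mu_tilde_nth axis_nth_if x y
  have t0: "t \<noteq> 0" "1 + t ^ 3 \<noteq> 0" and a0: "a \<noteq> 0"
    using t l(2) by (auto simp: a_def add_pos_pos less_imp_neq[symmetric])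
  have x6: "x $ 6 = 0" using lx[of 3] t0 a0 by (simp add: S)
  have x4: "x $ 4 = 0" using lx[of 5] t0 a0 by (simp add: S)
  have x5: "x $ 5 * a + t * c = 0" using lx[of 4] by (simp add: S)
  have x3: "t * x $ 3 * a + b = 0" using lx[of 6] by (simp add: S)
  have y6: "t * y $ 6 * a + c = 0" using ly[of 3] by (simp add: S)
  have y4: "y $ 4 * a + t * b = 0" using ly[of 5] by (simp add: S)
  have c8: "y $ 6 + t * x $ 5 = 0" using arg_cong[OF xy, of "\<lambda>z. z $ 8"] by (simp add: S x6)
  have c9: "x $ 3 + t * y $ 4 = 0" using arg_cong[OF xy, of "\<lambda>z. z $ 9"] by (simp add: S x4)
  have c7: "x $ 5 * y $ 4 + t * (x $ 3 * y $ 6) + 1 = 0"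
    using arg_cong[OF xy, of "\<lambda>z. z $ 7"] by (simp add: S x4 x6)
  have "(1 + t ^ 3) * c = (t * y $ 6 * a + c) + t\<^sup>2 * (x $ 5 * a + t * c) - t * a * (y $ 6 + t * x $ 5)"
    by (simp add: algebra_simps power2_eq_square power3_eq_cube)
  then have c: "c = 0" unfolding y6 x5 c8 using t0 by simp
  have "(1 + t ^ 3) * b = (t * x $ 3 * a + b) + t\<^sup>2 * (y $ 4 * a + t * b) - t * a * (x $ 3 + t * y $ 4)"
    by (simp add: algebra_simps power2_eq_square power3_eq_cube)
  then have b: "b = 0" unfolding x3 y4 c9 using t0 by simp
  have "x $ 5 = 0" using x5 c a0 by simp
  moreover have "x $ 3 = 0" using x3 b a0 t0 by simp
  ultimately show False using c7 by simp
qed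

section \<open>Orthonormal bases adapted to a flag\<close>

text \<open>A basis \<open>U\<close> of \<open>F m\<close> in which the vectors of level at most \<open>k\<close> form a basis of \<open>F k\<close>; the level is
  the block to which a vector belongs.\<close>

definition adapted_basis :: "nat \<Rightarrow> (nat \<Rightarrow> 'a::euclidean_space set) \<Rightarrow> 'a set \<Rightarrow> ('a \<Rightarrow> nat) \<Rightarrow> bool" where
  "adapted_basis m F U lev \<longleftrightarrow> (\<forall>u\<in>U. 1 \<le> lev u \<and> lev u \<le> m) \<and>
     (\<forall>k\<le>m. orthonormal_basis_of {u \<in> U. lev u \<le> k} (F k))"

lemma adapted_basis_exists:
  fixes F :: "nat \<Rightarrow> 'a::euclidean_space set"
  assumes F: "\<And>k. subspace (F k)" "mono F" "F 0 = {0}"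
  shows "\<exists>U lev. adapted_basis m F U lev"
proof (induction m)
  case 0
  have "adapted_basis 0 F {} (\<lambda>_. 0)"
    using F(3) by (auto simp: adapted_basis_def orthonormal_basis_of_def)
  then show ?case by blast
next
  case (Suc m)
  then obtain U lev where U: "\<And>u. u \<in> U \<Longrightarrow> 1 \<le> lev u \<and> lev u \<le> m"
      "\<And>k. k \<le> m \<Longrightarrow> orthonormal_basis_of {u \<in> U. lev u \<le> k} (F k)"
    by (auto simp: adapted_basis_def)
  have Um: "{u \<in> U. lev u \<le> m} = U" using U(1) by blast
  have "F m \<subseteq> F (Suc m)" using F(2) by (simp add: mono_def)
  with U(2)[of m] obtain V where V: "orthonormal_basis_of (U \<union> V) (F (Suc m))" "U \<inter> V = {}"
    unfolding Um using orthonormal_basis_extend[OF _ _ F(1)] by (metis order_refl)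
  define lev' where "lev' u = (if u \<in> U then lev u else Suc m)" for u
  have lt: "{u \<in> U \<union> V. lev' u \<le> k} = {u \<in> U. lev u \<le> k}" if "k \<le> m" for k
    using that V(2) by (auto simp: lev'_def)
  have eq: "{u \<in> U \<union> V. lev' u \<le> Suc m} = U \<union> V"
    using U(1) by (force simp: lev'_def)
  have "orthonormal_basis_of {u \<in> U \<union> V. lev' u \<le> k} (F k)" if "k \<le> Suc m" for k
  proof (cases "k \<le> m")
    case True
    then show ?thesis using lt U(2) by simp
  next
    case False
    then have "k = Suc m" using that by simp
    then show ?thesis using eq V(1) by simp
  qed
  moreover have "1 \<le> lev' u \<and> lev' u \<le> Suc m" if "u \<in> U \<union> V" for u
    using U(1)[of u] that by (auto simp: lev'_def)
  ultimately have "adapted_basis (Suc m) F (U \<union> V) lev'"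
    by (simp add: adapted_basis_def)
  then show ?case by blast
qed

lemma adapted_basis_orthogonal:
  assumes U: "adapted_basis m F U lev" and u: "u \<in> U" "k < lev u" and x: "x \<in> F k"
  shows "x \<bullet> u = 0"
proof -
  have m: "lev u \<le> m" using U u by (auto simp: adapted_basis_def)
  have k: "orthonormal_basis_of {v \<in> U. lev v \<le> k} (F k)"
    and top: "orthonormal_basis_of {v \<in> U. lev v \<le> m} (F m)"
    using U u m by (auto simp: adapted_basis_def)
  have "x = (\<Sum>v\<in>{v \<in> U. lev v \<le> k}. (x \<bullet> v) *\<^sub>R v)"
    by (rule orthonormal_basis_expand[OF k x])
  then have "x \<bullet> u = (\<Sum>v\<in>{v \<in> U. lev v \<le> k}. (x \<bullet> v) *\<^sub>R v) \<bullet> u"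
    by (rule arg_cong)
  also have "\<dots> = (\<Sum>v\<in>{v \<in> U. lev v \<le> k}. (x \<bullet> v) * (v \<bullet> u))"
    by (simp add: inner_sum_left)
  also have "\<dots> = 0"
  proof (rule sum.neutral, clarify)
    fix v assume v: "v \<in> U" "lev v \<le> k"
    then have "v \<noteq> u" "v \<in> {v \<in> U. lev v \<le> m}" "u \<in> {v \<in> U. lev v \<le> m}"
      using u m by auto
    then have "v \<bullet> u = 0" using orthonormal_basis_inner[OF top] by simp
    then show "(x \<bullet> v) * (v \<bullet> u) = 0" by simp
  qed
  finally show ?thesis .
qed

lemma adapted_basis_mem:
  assumes U: "adapted_basis m F U lev" and u: "u \<in> U" "lev u \<le> k" "k \<le> m"
  shows "u \<in> F k"
proof -
  have "span {v \<in> U. lev v \<le> k} = F k"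
    using U u by (auto simp: adapted_basis_def orthonormal_basis_of_def)
  moreover have "u \<in> span {v \<in> U. lev v \<le> k}"
    by (rule span_base) (use u in simp)
  ultimately show ?thesis by simp
qed

text \<open>Summation by parts.  Traces are computable on the members of a flag, which are invariant, and not on the
  single blocks; so a weighted sum over blocks is rewritten in terms of sums over all levels up to \<open>k\<close>.\<close>

lemma sum_by_level:
  fixes \<phi> :: "nat \<Rightarrow> real" and G :: "'a \<Rightarrow> real"
  assumes U: "finite U" "\<And>u. u \<in> U \<Longrightarrow> 1 \<le> lev u" and \<phi>: "\<phi> (Suc m) = 0" "\<And>u. u \<in> U \<Longrightarrow> lev u \<le> Suc m"
  shows "(\<Sum>u\<in>U. \<phi> (lev u) * G u) =
    (\<Sum>k=1..m. (\<phi> k - \<phi> (Suc k)) * (\<Sum>u\<in>{u \<in> U. lev u \<le> k}. G u))"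
proof -
  have tele: "(\<Sum>k\<in>{k \<in> {1..m}. l \<le> k}. \<phi> k - \<phi> (Suc k)) = \<phi> l" if "1 \<le> l" "l \<le> Suc m" for l
  proof -
    have "{k \<in> {1..m}. l \<le> k} = {l..<Suc m}" using that by auto
    then have "(\<Sum>k\<in>{k \<in> {1..m}. l \<le> k}. \<phi> k - \<phi> (Suc k)) = - (\<Sum>k = l..<Suc m. \<phi> (Suc k) - \<phi> k)"
      by (simp add: sum_negf[symmetric])
    also have "\<dots> = \<phi> l" using sum_Suc_diff'[OF that(2), of \<phi>] \<phi>(1) by simp
    finally show ?thesis .
  qed
  have "(\<Sum>k=1..m. (\<phi> k - \<phi> (Suc k)) * (\<Sum>u\<in>{u \<in> U. lev u \<le> k}. G u))
      = (\<Sum>k=1..m. \<Sum>u\<in>U. if lev u \<le> k then (\<phi> k - \<phi> (Suc k)) * G u else 0)"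
    using U(1) by (auto simp: sum_distrib_left sum.inter_filter intro!: sum.cong)
  also have "\<dots> = (\<Sum>u\<in>U. \<Sum>k=1..m. if lev u \<le> k then (\<phi> k - \<phi> (Suc k)) * G u else 0)"
    by (rule sum.swap)
  also have "\<dots> = (\<Sum>u\<in>U. \<phi> (lev u) * G u)"
  proof (intro sum.cong refl)
    fix u assume u: "u \<in> U"
    have "(\<Sum>k=1..m. if lev u \<le> k then (\<phi> k - \<phi> (Suc k)) * G u else 0)
        = (\<Sum>k\<in>{k \<in> {1..m}. lev u \<le> k}. \<phi> k - \<phi> (Suc k)) * G u"
      by (subst sum.inter_filter[symmetric]) (simp_all add: sum_distrib_right)
    then show "(\<Sum>k=1..m. if lev u \<le> k then (\<phi> k - \<phi> (Suc k)) * G u else 0) = \<phi> (lev u) * G u"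
      using tele U(2) \<phi>(2) u by simp
  qed
  finally show ?thesis by (rule sym)
qed

section \<open>Solvable Lie algebras with the given nilradical\<close>

text \<open>The flag of the nilradical that is used throughout: \<open>e 7\<close>, then the centre, then the span of
  \<open>e 3, \<dots>, e 9\<close>, then everything.  For \<open>t > 1\<close> all derivations preserve it.\<close>

definition level_index :: "nat \<Rightarrow> 9 set" where
  "level_index k = (if k = 0 then {} else if k = 1 then {7} else if k = 2 then {7, 8, 9}
     else if k = 3 then {3, 4, 5, 6, 7, 8, 9} else UNIV)"

locale mu_tilde_nilradical =
  fixes t :: real and br :: "'s::euclidean_space \<Rightarrow> 's \<Rightarrow> 's" and f :: "real ^ 9 \<Rightarrow> 's"
  assumes t: "1 < t"
    and lie: "is_lie_bracket br" and solvable: "solvable_lie br"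
    and lin_f: "linear f" and inj_f: "inj f"
    and hom_f: "\<And>x y. f (mu_tilde t x y) = br (f x) (f y)"
    and nilradical: "is_nilradical br (range f)"
begin

sublocale skew_bracket br
  using lie by unfold_locales (auto simp: is_lie_bracket_def)

lemma jacobi: "br x (br y z) = br (br x y) z + br y (br x z)"
proof -
  have "br x (br y z) + br y (br z x) + br z (br x y) = 0"
    using lie by (auto simp: is_lie_bracket_def)
  then show ?thesis
    using skew[of z "br x y"] skew[of z x] by (simp add: br_simps algebra_simps)
qed

lemma br_in_range: "br x (f y) \<in> range f"
  using nilradical by (auto simp: is_nilradical_def nilpotent_ideal_def)

definition ad_n :: "'s \<Rightarrow> real ^ 9 \<Rightarrow> real ^ 9" where
  "ad_n x y = inv f (br x (f y))"

lemma f_ad_n: "f (ad_n x y) = br x (f y)"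
  unfolding ad_n_def using br_in_range by (rule f_inv_into_f)

lemma ad_n_eqI: "f z = br x (f y) \<Longrightarrow> ad_n x y = z"
  using f_ad_n[of x y] inj_f by (metis injD)

lemma derivation_ad_n: "is_derivation (mu_tilde t) (ad_n x)"
  unfolding is_derivation_def linear_iff
proof (intro conjI allI)
  show "ad_n x (y + z) = ad_n x y + ad_n x z" for y z
    by (rule ad_n_eqI) (simp add: linear_add[OF lin_f] f_ad_n br_simps)
  show "ad_n x (r *\<^sub>R y) = r *\<^sub>R ad_n x y" for r y
    by (rule ad_n_eqI) (simp add: linear_cmul[OF lin_f] f_ad_n br_simps)
  show "ad_n x (mu_tilde t y z) = mu_tilde t (ad_n x y) z + mu_tilde t y (ad_n x z)" for y z
    by (rule ad_n_eqI) (simp add: linear_add[OF lin_f] f_ad_n hom_f jacobi[symmetric])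
qed

lemma ad_n_br: "ad_n (br x y) z = ad_n x (ad_n y z) - ad_n y (ad_n x z)"
  by (rule ad_n_eqI) (simp add: linear_diff[OF lin_f] f_ad_n jacobi[of x y])

text \<open>The elements that act on the nilradical by maps from the quotient by the centre into the centre.
  Since derivations are diagonal modulo such maps, all commutators belong to it.\<close>

definition strict_part :: "'s set" where
  "strict_part = {x. (\<forall>y. ad_n x y \<in> coordinate_subspace {7, 8, 9}) \<and>
     (\<forall>y\<in>coordinate_subspace {7, 8, 9}. ad_n x y = 0)}"

lemma subspace_strict_part: "subspace strict_part"
proof -
  have "ad_n 0 y = 0" "ad_n (x + x') y = ad_n x y + ad_n x' y" "ad_n (r *\<^sub>R x) y = r *\<^sub>R ad_n x y"
    for x x' y r
    by (rule ad_n_eqI; simp add: linear_0[OF lin_f] linear_add[OF lin_f] linear_cmul[OF lin_f]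
        f_ad_n br_simps)+
  then show ?thesis
    by (simp add: strict_part_def subspace_def coordinate_subspace_def)
qed

lemma bracket_in_strict_part: "bracket_span br A B \<subseteq> strict_part"
  unfolding bracket_span_def
proof (rule span_minimal[OF _ subspace_strict_part], clarify)
  fix x y
  define d where "d a i = ad_n a (e i) $ i" for a i
  have quot: "ad_n a z $ i = z $ i * d a i" if "i \<notin> {7, 8, 9}" for a z i
    unfolding d_def by (rule derivation_nth_quotient[OF t derivation_ad_n that])
  have "ad_n (br x y) z $ i = 0" if "i \<notin> {7, 8, 9}" for z i
    by (simp add: ad_n_br quot[OF that])
  moreover have "ad_n (br x y) z = 0" if z: "z \<in> coordinate_subspace {7, 8, 9}" for z
  proof -
    have centre: "ad_n a w $ i = w $ i * d a i" if "w \<in> coordinate_subspace {7, 8, 9}" for a w i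
      unfolding d_def by (rule derivation_nth_centre[OF t derivation_ad_n that])
    have "ad_n a z \<in> coordinate_subspace {7, 8, 9}" for a
      by (rule derivation_preserves_coordinate_subspace[OF t derivation_ad_n _ z]) simp
    then show ?thesis
      using z by (simp add: ad_n_br vec_eq_iff centre)
  qed
  ultimately show "br x y \<in> strict_part"
    by (simp add: strict_part_def coordinate_subspace_def)
qed

lemma strict_part_bracket: "x \<in> strict_part \<Longrightarrow> br x (f y) \<in> f ` coordinate_subspace {7, 8, 9}"
  by (auto simp: strict_part_def simp flip: f_ad_n)

lemma strict_part_bracket_centre:
  "x \<in> strict_part \<Longrightarrow> y \<in> f ` coordinate_subspace {7, 8, 9} \<Longrightarrow> br x y = 0"
  by (auto simp: strict_part_def linear_0[OF lin_f] simp flip: f_ad_n)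

lemma derived_series_ideal: "y \<in> derived_series br k \<Longrightarrow> br x y \<in> derived_series br k"
proof (induction k arbitrary: x y)
  case (Suc k)
  define G where "G = {br a b |a b. a \<in> derived_series br k \<and> b \<in> derived_series br k}"
  have "y \<in> span G" using Suc.prems by (simp add: bracket_span_def G_def)
  then have "br x y \<in> span G"
  proof (induction rule: span_induct)
    case base
    show ?case by (auto simp: subspace_def br_simps span_add span_scale span_zero)
  next
    case (step y)
    then obtain a b where ab: "y = br a b" "a \<in> derived_series br k" "b \<in> derived_series br k"
      by (auto simp: G_def)
    have "br (br x a) b \<in> span G" "br a (br x b) \<in> span G"
      using ab Suc.IH by (auto simp: G_def intro!: span_base)
    then show ?case unfolding ab(1) jacobi[of x a b] by (rule span_add)
  qed
  then show ?case by (simp add: bracket_span_def G_def)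
qed simp

text \<open>Descending induction along the derived series.  Let \<open>J\<close> be a term after the zeroth whose successor
  \<open>[J, J]\<close> already lies in the nilradical.  Being spanned by commutators, \<open>J\<close> acts strictly, so \<open>[J, [J, J]]\<close>
  is contained in the centre of the nilradical and \<open>[J, [J, [J, J]]] = 0\<close>.  Thus \<open>J\<close> is a nilpotent ideal and lies
  in the nilradical as well.\<close>

lemma derived_algebra_subset: "bracket_span br UNIV UNIV \<subseteq> range f"
proof -
  have sub: "subspace (derived_series br k)" for k
    by (cases k) (auto simp: bracket_span_def)
  obtain m where m: "derived_series br m = {0}" using solvable by (auto simp: solvable_lie_def)
  have zero: "{br x y |x y. x \<in> {0} \<and> y \<in> {0}} = {0}" by (auto simp: skew0)
  have "0 \<in> range f" by (rule range_eqI[of _ _ 0]) (simp add: linear_0[OF lin_f])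
  then have last: "derived_series br (Suc m) \<subseteq> range f"
    unfolding derived_series.simps m bracket_span_def zero by simp
  have "derived_series br (Suc 0) \<subseteq> range f"
  proof (rule inc_induct[of "Suc 0" "Suc m" "\<lambda>k. derived_series br k \<subseteq> range f", OF _ last])
    fix k assume k: "Suc 0 \<le> k" and step: "derived_series br (Suc k) \<subseteq> range f"
    define J where "J = derived_series br k"
    obtain k' where k': "k = Suc k'" using k by (cases k) auto
    have J: "J \<subseteq> strict_part"
      unfolding J_def k' derived_series.simps by (rule bracket_in_strict_part)
    have 1: "lower_central br J 1 \<subseteq> range f"
      using step by (simp add: J_def)
    have 2: "lower_central br J 2 \<subseteq> f ` coordinate_subspace {7, 8, 9}"
      unfolding numeral_2_eq_2 lower_central.simps(2)[of _ _ "Suc 0"]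
      unfolding bracket_span_def
    proof (intro span_minimal linear_subspace_image[OF lin_f] subspace_coordinate_subspace, clarify)
      fix a b assume a: "a \<in> J" and b: "b \<in> lower_central br J (Suc 0)"
      obtain v where "b = f v" using b 1 by auto
      with a J show "br a b \<in> f ` coordinate_subspace {7, 8, 9}"
        using strict_part_bracket by blast
    qed
    have "lower_central br J 3 \<subseteq> {0}"
      unfolding numeral_3_eq_3 lower_central.simps(2)[of _ _ "Suc (Suc 0)"]
      unfolding bracket_span_def
    proof (intro span_minimal, clarify)
      fix a b assume a: "a \<in> J" and b: "b \<in> lower_central br J (Suc (Suc 0))"
      have "b \<in> f ` coordinate_subspace {7, 8, 9}" using b 2 by (auto simp: numeral_2_eq_2)
      with a J show "br a b = 0"
        using strict_part_bracket_centre by blast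
    qed simp
    moreover have "0 \<in> lower_central br J 3"
      by (simp add: numeral_3_eq_3 bracket_span_def span_zero)
    ultimately have "lower_central br J 3 = {0}" by blast
    then have "nilpotent_ideal br J"
      unfolding nilpotent_ideal_def using sub derived_series_ideal by (auto simp: J_def)
    then show "derived_series br k \<subseteq> range f"
      using nilradical by (simp add: is_nilradical_def J_def)
  qed simp
  then show ?thesis by simp
qed

lemma br_in_nilradical: "br x y \<in> range f"
proof -
  have "br x y \<in> bracket_span br UNIV UNIV"
    unfolding bracket_span_def by (rule span_base) blast
  then show ?thesis using derived_algebra_subset by blast
qed

definition flag :: "nat \<Rightarrow> 's set" where
  "flag k = (if k \<le> 4 then f ` coordinate_subspace (level_index k) else UNIV)"

lemma range_eq_flag: "range f = flag 4"
  by (auto simp: flag_def level_index_def coordinate_subspace_def)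

lemma subspace_flag: "subspace (flag k)"
  by (simp add: flag_def linear_subspace_image[OF lin_f] subspace_coordinate_subspace)

lemma mono_flag: "mono flag"
proof
  fix k l :: nat assume "k \<le> l"
  then have "level_index k \<subseteq> level_index l"
    by (auto simp: level_index_def)
  then have "coordinate_subspace (level_index k) \<subseteq> coordinate_subspace (level_index l)"
    by (auto simp: coordinate_subspace_def)
  then show "flag k \<subseteq> flag l"
    using \<open>k \<le> l\<close> by (auto simp: flag_def)
qed

lemma flag_0: "flag 0 = {0}"
proof -
  have "coordinate_subspace (level_index 0) = {0}"
    by (auto simp: coordinate_subspace_def level_index_def vec_eq_iff)
  then show ?thesis by (simp add: flag_def linear_0[OF lin_f])
qed

lemma br_flag: "y \<in> flag k \<Longrightarrow> k \<le> 4 \<Longrightarrow> br x y \<in> flag k"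
proof -
  assume y: "y \<in> flag k" and k: "k \<le> 4"
  then obtain v where v: "v \<in> coordinate_subspace (level_index k)" "y = f v"
    by (auto simp: flag_def)
  have "level_index k \<subseteq> {7, 8, 9} \<or> {7, 8, 9} \<subseteq> level_index k"
    by (auto simp: level_index_def)
  then have "ad_n x v \<in> coordinate_subspace (level_index k)"
    by (rule derivation_preserves_coordinate_subspace[OF t derivation_ad_n _ v(1)])
  then show ?thesis
    using k v(2) by (auto simp: flag_def simp flip: f_ad_n)
qed

lemma br_flag_4_4: "x \<in> flag 4 \<Longrightarrow> y \<in> flag 4 \<Longrightarrow> br x y \<in> flag 2"
proof -
  assume "x \<in> flag 4" "y \<in> flag 4"
  then obtain u v where uv: "x = f u" "y = f v"
    by (auto simp: flag_def)
  have "mu_tilde t u v \<in> coordinate_subspace {7, 8, 9}"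
    by (simp add: coordinate_subspace_def mu_tilde_nth)
  then show ?thesis using uv by (simp add: flag_def level_index_def flip: hom_f)
qed

lemma br_flag_4_2: "x \<in> flag 4 \<Longrightarrow> y \<in> flag 2 \<Longrightarrow> br x y = 0"
proof -
  assume "x \<in> flag 4" "y \<in> flag 2"
  then obtain u v where uv: "x = f u" "y = f v" "\<forall>i. i \<notin> {7, 8, 9} \<longrightarrow> v $ i = 0"
    by (auto simp: flag_def level_index_def coordinate_subspace_def)
  have "mu_tilde t u v = 0"
    using uv(3) by (simp add: vec_eq_iff mu_tilde_nth)
  then show ?thesis using uv hom_f[of u v] linear_0[OF lin_f] by simp
qed

lemma br_flag_3_3: "x \<in> flag 3 \<Longrightarrow> y \<in> flag 3 \<Longrightarrow> br x y \<in> flag 1"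
proof -
  assume "x \<in> flag 3" "y \<in> flag 3"
  then obtain u v where uv: "x = f u" "y = f v"
    "\<forall>i. i \<notin> {3, 4, 5, 6, 7, 8, 9} \<longrightarrow> u $ i = 0" "\<forall>i. i \<notin> {3, 4, 5, 6, 7, 8, 9} \<longrightarrow> v $ i = 0"
    by (auto simp: flag_def level_index_def coordinate_subspace_def)
  have "mu_tilde t u v \<in> coordinate_subspace {7}"
    using uv(3,4) by (simp add: coordinate_subspace_def mu_tilde_nth)
  then show ?thesis using uv by (simp add: flag_def level_index_def flip: hom_f)
qed

end

section \<open>Standard Einstein metrics with the given nilradical\<close>

text \<open>The equality case of the weighted Einstein equation: a vanishing sum of structure constants, all weighted
  with the same sign, vanishes term by term.\<close>

lemma sum3_signed_eq_0:
  fixes A :: "'a \<Rightarrow> 'a \<Rightarrow> 'a \<Rightarrow> real"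
  assumes U: "finite U" and nn: "\<And>u v w. u \<in> U \<Longrightarrow> v \<in> U \<Longrightarrow> w \<in> U \<Longrightarrow> 0 \<le> A u v w"
    and zero: "(\<Sum>u\<in>U. \<Sum>v\<in>U. \<Sum>w\<in>U. A u v w) = 0"
    and u: "u \<in> U" "v \<in> U" "w \<in> U"
  shows "A u v w = 0"
proof -
  have "(\<Sum>v\<in>U. \<Sum>w\<in>U. A u v w) = 0"
    using zero sum_nonneg_0[OF U _ zero u(1)] by (simp add: nn sum_nonneg)
  then have "(\<Sum>w\<in>U. A u v w) = 0"
    using sum_nonneg_0[OF U _ _ u(2), of "\<lambda>v. \<Sum>w\<in>U. A u v w"] u nn by (simp add: sum_nonneg)
  then show ?thesis
    using sum_nonneg_0[OF U _ _ u(3), of "A u v"] u nn by simp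
qed

text \<open>The weights of the derivation that is \<open>1\<close> on \<open>e 1, \<dots>, e 6\<close> and \<open>2\<close> on the centre, with \<open>0\<close> on the
  complement of the nilradical (level 5).\<close>

definition grading_weight :: "nat \<Rightarrow> real" where
  "grading_weight k = (if k \<le> 2 then 2 else if k \<le> 4 then 1 else 0)"

text \<open>The weights of \<open>diag(2, 2, -1, -1, -1, -1, -2, 1, 1)\<close>.  With these weights \<open>[e 1, e 2] = e 7\<close> has weight \<open>-6\<close>
  and every other bracket of basis vectors has weight \<open>0\<close>, so the corresponding one-parameter group
  contracts the bracket to the one without \<open>[e 1, e 2]\<close>.  The weights sum to zero and are orthogonal to
  the grading weights.\<close>

definition degeneration_weight :: "nat \<Rightarrow> real" where
  "degeneration_weight k = (if k = 1 then -2 else if k = 2 then 1 else if k = 3 then -1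
     else if k = 4 then 2 else 0)"

locale adapted_einstein = mu_tilde_nilradical t br f
  for t and br :: "'s::euclidean_space \<Rightarrow> 's \<Rightarrow> 's" and f +
  fixes c :: real and U :: "'s set" and lev :: "'s \<Rightarrow> nat"
  assumes standard: "standard_metric br"
    and einstein: "\<And>x y. ricci br x y = c * (x \<bullet> y)"
    and adapted: "adapted_basis 5 flag U lev"
begin

abbreviation H :: 's where "H \<equiv> mean_curvature br"

lemma U_UNIV: "orthonormal_basis_of U UNIV"
proof -
  have "{u \<in> U. lev u \<le> 5} = U" using adapted by (auto simp: adapted_basis_def)
  moreover have "orthonormal_basis_of {u \<in> U. lev u \<le> 5} (flag 5)"
    using adapted by (auto simp: adapted_basis_def)
  ultimately show ?thesis by (simp add: flag_def)
qed

lemma finite_U: "finite U"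
  using U_UNIV by (simp add: orthonormal_basis_of_def)

lemma lev_bounds: "u \<in> U \<Longrightarrow> 1 \<le> lev u \<and> lev u \<le> 5"
  using adapted by (auto simp: adapted_basis_def)

lemma level_onb: "k \<le> 5 \<Longrightarrow> orthonormal_basis_of {u \<in> U. lev u \<le> k} (flag k)"
  using adapted by (auto simp: adapted_basis_def)

lemma in_flag: "u \<in> U \<Longrightarrow> lev u \<le> k \<Longrightarrow> k \<le> 5 \<Longrightarrow> u \<in> flag k"
  by (rule adapted_basis_mem[OF adapted])

lemma flag_orthogonal: "x \<in> flag k \<Longrightarrow> u \<in> U \<Longrightarrow> k < lev u \<Longrightarrow> x \<bullet> u = 0"
  using adapted_basis_orthogonal[OF adapted] by blast

lemma orthogonal_derived_algebra:
  assumes "\<And>y. y \<in> range f \<Longrightarrow> y \<bullet> x = 0"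
  shows "x \<in> orthogonal_comp (bracket_span br UNIV UNIV)"
  using assms derived_algebra_subset
  by (auto simp: orthogonal_comp_def orthogonal_def)

lemma level_5_orthogonal_derived: "u \<in> U \<Longrightarrow> lev u = 5 \<Longrightarrow> u \<in> orthogonal_comp (bracket_span br UNIV UNIV)"
  by (rule orthogonal_derived_algebra) (auto simp: range_eq_flag intro: flag_orthogonal)

text \<open>The combinatorial shape of the bracket in an adapted basis.  It combines the invariance of the flag under
  all derivations, \<open>[s, s] \<subseteq> n\<close>, commutativity of the complement of the nilradical, and the bracket
  relations of the nilradical with respect to the flag.\<close>

lemma structure_constant_levels:
  assumes U: "u \<in> U" "v \<in> U" "w \<in> U" and nz: "br u v \<bullet> w \<noteq> 0"
  shows "(lev u = 5 \<and> lev v \<in> {1, 2, 3, 4} \<and> lev w \<in> {1..lev v}) \<or>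
    (lev v = 5 \<and> lev u \<in> {1, 2, 3, 4} \<and> lev w \<in> {1..lev u}) \<or>
    (lev u \<in> {3, 4} \<and> lev v \<in> {3, 4} \<and> lev w \<in> {1, 2} \<and> \<not> (lev u = 3 \<and> lev v = 3 \<and> lev w = 2))"
proof -
  have in_flag_le: "lev w \<le> k" if "br u v \<in> flag k" for k
    using flag_orthogonal[OF that U(3)] nz by (meson not_le)
  have b: "1 \<le> lev u" "lev u \<le> 5" "1 \<le> lev v" "lev v \<le> 5" "1 \<le> lev w"
    using lev_bounds U by auto
  have lv: "lev w \<le> lev v" if "lev v \<le> 4"
    using in_flag_le br_flag[OF in_flag[OF U(2) order_refl b(4)] that] by blast
  have lu: "lev w \<le> lev u" if "lev u \<le> 4"
  proof -
    have "br v u \<in> flag (lev u)" using br_flag[OF in_flag[OF U(1) order_refl b(2)] that] by blast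
    then have "br u v \<in> flag (lev u)" using subspace_neg[OF subspace_flag] skew[of u v] by simp
    then show ?thesis by (rule in_flag_le)
  qed
  have not55: "\<not> (lev u = 5 \<and> lev v = 5)"
    using standard level_5_orthogonal_derived U nz by (auto simp: standard_metric_def)
  have mem: "u \<in> flag 4" if "lev u \<le> 4" using in_flag[OF U(1) that] by simp
  have mem': "v \<in> flag 4" if "lev v \<le> 4" using in_flag[OF U(2) that] by simp
  have v3: "3 \<le> lev v" if "lev u \<le> 4"
  proof (rule ccontr)
    assume "\<not> 3 \<le> lev v"
    then have "v \<in> flag 2" using in_flag[OF U(2)] by simp
    then show False using br_flag_4_2[OF mem[OF that]] nz by simp
  qed
  have u3: "3 \<le> lev u" if "lev v \<le> 4"
  proof (rule ccontr)
    assume "\<not> 3 \<le> lev u"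
    then have "u \<in> flag 2" using in_flag[OF U(1)] by simp
    then show False using br_flag_4_2[OF mem'[OF that]] nz skew[of u v] by simp
  qed
  have w2: "lev w \<le> 2" if "lev u \<le> 4" "lev v \<le> 4"
    by (rule in_flag_le[OF br_flag_4_4[OF mem[OF that(1)] mem'[OF that(2)]]])
  have w1: "lev w \<le> 1" if "lev u = 3" "lev v = 3"
    using in_flag_le br_flag_3_3 in_flag[OF U(1)] in_flag[OF U(2)] that by simp
  consider "lev u = 5" | "lev v = 5" | "lev u \<le> 4" "lev v \<le> 4" using b by linarith
  then show ?thesis
  proof cases
    case 1
    then show ?thesis using not55 lv b by auto
  next
    case 2
    then show ?thesis using not55 lu b by auto
  next
    case 3
    have "lev u = 3 \<or> lev u = 4" "lev v = 3 \<or> lev v = 4" "lev w = 1 \<or> lev w = 2"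
      using u3 v3 w2 3 b by linarith+
    then show ?thesis using w1 by auto
  qed
qed

text \<open>For \<open>u\<close> in the nilradical, \<open>ad u\<close> is nilpotent, so the trace of its square vanishes; in the adapted basis
  this holds term by term.\<close>

lemma killing_zero:
  assumes "u \<in> U" "lev u \<noteq> 5"
  shows "(\<Sum>v\<in>U. \<Sum>w\<in>U. (br u v \<bullet> w) * (br u w \<bullet> v)) = 0"
proof (intro sum.neutral ballI)
  fix v w assume vw: "v \<in> U" "w \<in> U"
  show "(br u v \<bullet> w) * (br u w \<bullet> v) = 0"
  proof (rule ccontr)
    assume "\<not> ?thesis"
    then have "br u v \<bullet> w \<noteq> 0" "br u w \<bullet> v \<noteq> 0" by auto
    note nz = this
    have "lev v = 5 \<or> lev w \<le> 2"
      using structure_constant_levels[OF assms(1) vw nz(1)] assms(2) by auto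
    moreover have "lev w \<le> 4"
      using structure_constant_levels[OF assms(1) vw nz(1)] by auto
    moreover have "lev v \<le> 4" "lev w = 5 \<or> 3 \<le> lev w"
      using structure_constant_levels[OF assms(1) vw(2,1) nz(2)] assms(2) by auto
    ultimately show False by linarith
  qed
qed

lemma weighted_einstein:
  assumes \<phi>: "\<phi> 5 = (0::real)"
  shows "(\<Sum>u\<in>U. \<Sum>v\<in>U. \<Sum>w\<in>U. (\<phi> (lev w) - \<phi> (lev u) - \<phi> (lev v)) * (br u v \<bullet> w)\<^sup>2)
    = 4 * ((\<Sum>u\<in>U. \<phi> (lev u) * (br H u \<bullet> u)) + c * (\<Sum>u\<in>U. \<phi> (lev u)))"
proof (rule ricci_weighted_sum[OF U_UNIV])
  show "ricci br u u = c" if "u \<in> U" for u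
    unfolding einstein orthonormal_basis_inner[OF U_UNIV that that] by simp
  show "(\<Sum>v\<in>U. \<Sum>w\<in>U. (br u v \<bullet> w) * (br u w \<bullet> v)) = 0" if "u \<in> U" "\<phi> (lev u) \<noteq> 0" for u
    by (rule killing_zero[OF that(1)]) (use that(2) \<phi> in auto)
qed

lemma mean_curvature_orthogonal: "y \<in> range f \<Longrightarrow> y \<bullet> H = 0"
proof -
  have basis: "H \<bullet> u = 0" if u: "u \<in> {u \<in> U. lev u \<le> 4}" for u
  proof -
    have "br u v \<bullet> v = 0" if v: "v \<in> U" for v
    proof (rule ccontr)
      assume "br u v \<bullet> v \<noteq> 0"
      with u v have "(lev u = 5 \<and> lev v \<in> {1, 2, 3, 4} \<and> lev v \<in> {1..lev v}) \<or>
        (lev v = 5 \<and> lev u \<in> {1, 2, 3, 4} \<and> lev v \<in> {1..lev u}) \<or>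
        (lev u \<in> {3, 4} \<and> lev v \<in> {3, 4} \<and> lev v \<in> {1, 2} \<and>
          \<not> (lev u = 3 \<and> lev v = 3 \<and> lev v = 2))"
        by (intro structure_constant_levels) auto
      with u show False by auto
    qed
    then show ?thesis unfolding mean_curvature_inner[OF U_UNIV] by (intro sum.neutral) simp
  qed
  assume "y \<in> range f"
  then have "y \<in> flag 4" by (simp add: range_eq_flag)
  then have "y \<bullet> H = (\<Sum>u\<in>{u \<in> U. lev u \<le> 4}. (y \<bullet> u) * (H \<bullet> u))"
    by (intro orthonormal_basis_parseval[OF level_onb]) simp_all
  then show ?thesis using basis by simp
qed

lemma level_trace:
  assumes k: "k \<le> 4" and L: "linear L" "\<And>x. x \<in> flag k \<Longrightarrow> L x \<in> flag k"
    and D: "\<And>x. L (f x) = f (D x)"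
  shows "(\<Sum>u\<in>{u \<in> U. lev u \<le> k}. L u \<bullet> u) = (\<Sum>i\<in>level_index k. D (e i) $ i)"
proof -
  obtain g where g: "linear g" "\<And>x. g (f x) = x"
    using linear_injective_left_inverse[OF lin_f inj_f] by (metis comp_apply id_apply)
  have "(\<Sum>u\<in>{u \<in> U. lev u \<le> k}. L u \<bullet> u) = (\<Sum>i\<in>level_index k. g (L (f (e i))) $ i)"
  proof (rule trace_orthonormal_basis[OF level_onb L])
    show "linear (\<lambda>x. g x $ i)" for i
      using g(1) by (simp add: linear_iff)
    show "f (e i) \<in> flag k" if "i \<in> level_index k" for i
      using k axis_in_coordinate_subspace[OF that] by (simp add: flag_def)
    show "x = (\<Sum>i\<in>level_index k. g x $ i *\<^sub>R f (e i))" if x: "x \<in> flag k" for x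
    proof -
      obtain y where y: "y \<in> coordinate_subspace (level_index k)" "x = f y"
        using x k by (auto simp: flag_def)
      have "f y = f (\<Sum>i\<in>level_index k. (y $ i) *\<^sub>R e i)"
        by (rule arg_cong[OF coordinate_subspace_sum_axis[OF y(1)]])
      also have "\<dots> = (\<Sum>i\<in>level_index k. (y $ i) *\<^sub>R f (e i))"
        by (simp add: linear_sum[OF lin_f] linear_cmul[OF lin_f])
      finally show ?thesis unfolding y(2) g(2) .
    qed
  qed (use k in simp_all)
  then show ?thesis by (simp add: D g(2))
qed

lemma level_card:
  assumes k: "k \<le> 4"
  shows "card {u \<in> U. lev u \<le> k} = card (level_index k)"
proof -
  have "(\<Sum>u\<in>{u \<in> U. lev u \<le> k}. u \<bullet> u) = (\<Sum>i\<in>level_index k. e i $ i)"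
    by (rule level_trace[OF k]) (auto simp: linear_iff)
  moreover have "u \<bullet> u = 1" if "u \<in> {u \<in> U. lev u \<le> k}" for u
    using orthonormal_basis_inner[OF U_UNIV] that by auto
  ultimately show ?thesis by simp
qed

lemma weighted_sum_levels:
  fixes \<phi> :: "nat \<Rightarrow> real"
  assumes "\<phi> 5 = 0"
  shows "(\<Sum>u\<in>U. \<phi> (lev u) * G u) = (\<phi> 1 - \<phi> 2) * (\<Sum>u\<in>{u \<in> U. lev u \<le> 1}. G u)
    + (\<phi> 2 - \<phi> 3) * (\<Sum>u\<in>{u \<in> U. lev u \<le> 2}. G u)
    + (\<phi> 3 - \<phi> 4) * (\<Sum>u\<in>{u \<in> U. lev u \<le> 3}. G u)
    + \<phi> 4 * (\<Sum>u\<in>{u \<in> U. lev u \<le> 4}. G u)"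
proof -
  have "{1..4} = {1, 2, 3, 4::nat}" by auto
  then show ?thesis
    using sum_by_level[of U lev \<phi> 4 G] finite_U lev_bounds assms by (simp add: eval_nat_numeral)
qed

lemma weight_total:
  assumes "\<phi> 5 = (0::real)"
  shows "(\<Sum>u\<in>U. \<phi> (lev u)) = \<phi> 1 + 2 * \<phi> 2 + 4 * \<phi> 3 + 2 * \<phi> 4"
proof -
  have "card {u \<in> U. lev u \<le> 1} = 1" "card {u \<in> U. lev u \<le> 2} = 3"
    "card {u \<in> U. lev u \<le> 3} = 7" "card {u \<in> U. lev u \<le> 4} = 9"
    using level_card[of 1] level_card[of 2] level_card[of 3] level_card[of 4]
    by (simp_all add: level_index_def)
  then show ?thesis
    using weighted_sum_levels[of \<phi> "\<lambda>_. 1"] assms by simp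
qed

text \<open>The trace of \<open>ad H\<close> is \<open>|H|\<^sup>2\<close> by definition of \<open>H\<close>, and it is carried by the nilradical, where it is
  shared equally between the centre and the quotient by the centre.\<close>

lemma trace_mean_curvature:
  shows "(\<Sum>u\<in>{u \<in> U. lev u \<le> 4}. br H u \<bullet> u) = H \<bullet> H"
    and "(\<Sum>u\<in>{u \<in> U. lev u \<le> 2}. br H u \<bullet> u) = (H \<bullet> H) / 2"
proof -
  have H: "H \<in> orthogonal_comp (bracket_span br UNIV UNIV)"
    by (rule orthogonal_derived_algebra) (rule mean_curvature_orthogonal)
  have "br H u \<bullet> u = 0" if "u \<in> U - {u \<in> U. lev u \<le> 4}" for u
  proof -
    have "lev u = 5" using that lev_bounds[of u] by auto
    then have "br H u = 0"
      using standard H level_5_orthogonal_derived that by (auto simp: standard_metric_def)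
    then show ?thesis by simp
  qed
  then have "(\<Sum>u\<in>{u \<in> U. lev u \<le> 4}. br H u \<bullet> u) = (\<Sum>u\<in>U. br H u \<bullet> u)"
    by (intro sum.mono_neutral_left finite_U) auto
  then show 1: "(\<Sum>u\<in>{u \<in> U. lev u \<le> 4}. br H u \<bullet> u) = H \<bullet> H"
    by (simp add: mean_curvature_inner[OF U_UNIV])
  have tr: "(\<Sum>u\<in>{u \<in> U. lev u \<le> k}. br H u \<bullet> u) = (\<Sum>i\<in>level_index k. ad_n H (e i) $ i)"
    if "k \<le> 4" for k
    using that by (intro level_trace linear_br br_flag) (simp_all add: f_ad_n)
  show "(\<Sum>u\<in>{u \<in> U. lev u \<le> 2}. br H u \<bullet> u) = (H \<bullet> H) / 2"
    using 1 tr[of 2] tr[of 4] derivation_trace[OF derivation_ad_n, of H]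
    by (simp add: level_index_def)
qed

text \<open>The trace \<open>12\<close> and the squared norm \<open>18\<close> of the grading operator, its inner product with \<open>ad H\<close>, and
  the sign of its weights: brackets inside the nilradical have weight \<open>0\<close>, and brackets with the
  complement have nonnegative weight because the centre, which carries the higher degree, is invariant.\<close>

lemma grading_weight_facts:
  shows "(\<Sum>u\<in>U. grading_weight (lev u) * (br H u \<bullet> u)) = 3 / 2 * (H \<bullet> H)"
    and "(\<Sum>u\<in>U. grading_weight (lev u)) = 12"
    and "(\<Sum>u\<in>U. (grading_weight (lev u))\<^sup>2) = 18"
    and "u \<in> U \<Longrightarrow> v \<in> U \<Longrightarrow> w \<in> U \<Longrightarrow>
      0 \<le> (grading_weight (lev w) - grading_weight (lev u) - grading_weight (lev v)) * (br u v \<bullet> w)\<^sup>2"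
proof -
  show "(\<Sum>u\<in>U. grading_weight (lev u) * (br H u \<bullet> u)) = 3 / 2 * (H \<bullet> H)"
    by (subst weighted_sum_levels) (simp_all add: grading_weight_def trace_mean_curvature)
  show "(\<Sum>u\<in>U. grading_weight (lev u)) = 12"
    by (subst weight_total) (simp_all add: grading_weight_def)
  show "(\<Sum>u\<in>U. (grading_weight (lev u))\<^sup>2) = 18"
    by (subst weight_total) (simp_all add: grading_weight_def)
  show "0 \<le> (grading_weight (lev w) - grading_weight (lev u) - grading_weight (lev v)) * (br u v \<bullet> w)\<^sup>2"
    if "u \<in> U" "v \<in> U" "w \<in> U"
  proof (cases "br u v \<bullet> w = 0")
    case False
    from structure_constant_levels[OF that False] have "0 \<le> grading_weight (lev w) - grading_weight (lev u) - grading_weight (lev v)"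
      by (auto simp: grading_weight_def)
    then show ?thesis by simp
  qed simp
qed

text \<open>Constant weight \<open>1\<close> on the nilradical gives \<open>9 c + |H|\<^sup>2 = - |\<mu>|\<^sup>2 / 4\<close>, where \<open>\<mu>\<close> is the bracket
  of the nilradical.\<close>

lemma einstein_constant_nonpos: "c \<le> 0"
proof -
  define \<omega> where "\<omega> k = (if k \<le> 4 then 1 else (0::real))" for k :: nat
  have "(\<omega> (lev w) - \<omega> (lev u) - \<omega> (lev v)) * (br u v \<bullet> w)\<^sup>2 \<le> 0"
    if "u \<in> U" "v \<in> U" "w \<in> U" for u v w
  proof (cases "br u v \<bullet> w = 0")
    case False
    from structure_constant_levels[OF that False] have "\<omega> (lev w) - \<omega> (lev u) - \<omega> (lev v) \<le> 0"
      by (auto simp: \<omega>_def)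
    then show ?thesis by (simp add: mult_nonpos_nonneg)
  qed simp
  then have "(\<Sum>u\<in>U. \<Sum>v\<in>U. \<Sum>w\<in>U. (\<omega> (lev w) - \<omega> (lev u) - \<omega> (lev v)) * (br u v \<bullet> w)\<^sup>2) \<le> 0"
    by (intro sum_nonpos)
  moreover have "(\<Sum>u\<in>U. \<omega> (lev u) * (br H u \<bullet> u)) = H \<bullet> H"
    by (subst weighted_sum_levels) (simp_all add: \<omega>_def trace_mean_curvature)
  moreover have "(\<Sum>u\<in>U. \<omega> (lev u)) = 9"
    by (subst weight_total) (simp_all add: \<omega>_def)
  moreover have "\<omega> 5 = 0" by (simp add: \<omega>_def)
  ultimately have "4 * (H \<bullet> H) + 36 * c \<le> 0"
    using weighted_einstein[of \<omega>] by simp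
  then show ?thesis
    using inner_ge_zero[of H] by linarith
qed

text \<open>The Einstein equation in the direction of \<open>H\<close>.\<close>

lemma symmetric_part_norm:
  "(\<Sum>u\<in>U. \<Sum>v\<in>U. ((br H u \<bullet> v + br H v \<bullet> u) / 2)\<^sup>2) = - c * (H \<bullet> H)"
proof -
  have "br u v \<bullet> H = 0" for u v
    by (rule mean_curvature_orthogonal[OF br_in_nilradical])
  then show ?thesis
    using ricci_orthonormal_basis[OF U_UNIV, of H] einstein[of H H]
    by (simp add: skew0 sum_negf)
qed

text \<open>Two opposite inequalities for \<open>h = |H|\<^sup>2\<close>.  The weighted Einstein equation with the grading weights has a
  nonnegative left hand side, whence \<open>h \<ge> - 8 c\<close>.  On the other hand the symmetric part \<open>S\<close> of \<open>ad H\<close>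
  satisfies \<open>|S|\<^sup>2 = - c h\<close>, while its inner product with the grading operator is \<open>3 h / 2\<close> and that
  operator has squared norm \<open>18\<close>; Cauchy-Schwarz gives \<open>h \<le> - 8 c\<close>.  Equality in
  Cauchy-Schwarz means that \<open>S\<close> is \<open>h / 12\<close> times the grading operator.\<close>

lemma mean_curvature_rigid:
  shows "H \<bullet> H = - 8 * c"
    and "u \<in> U \<Longrightarrow> br H u \<bullet> u = (H \<bullet> H) / 12 * grading_weight (lev u)"
proof -
  define h where "h = H \<bullet> H"
  define r where "r = h / 12"
  define S where "S u v = (br H u \<bullet> v + br H v \<bullet> u) / 2" for u v
  have h: "0 \<le> h" by (simp add: h_def)
  have G5: "grading_weight 5 = 0" by (simp add: grading_weight_def)
  have "0 \<le> (\<Sum>u\<in>U. \<Sum>v\<in>U. \<Sum>w\<in>U. (grading_weight (lev w) - grading_weight (lev u) - grading_weight (lev v)) * (br u v \<bullet> w)\<^sup>2)"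
    by (intro sum_nonneg grading_weight_facts(4))
  also have "\<dots> = 4 * (3 / 2 * h + c * 12)"
    unfolding weighted_einstein[of grading_weight, OF G5] grading_weight_facts(1,2) h_def ..
  finally have lower: "- 8 * c \<le> h" by simp
  \<comment> \<open>Cauchy-Schwarz in the form: the squared distance of \<open>S\<close> to its projection onto the line spanned
    by the grading operator is nonnegative.\<close>
  have diag: "(\<Sum>v\<in>U. (S u v - (if u = v then r * grading_weight (lev u) else 0))\<^sup>2)
      = (\<Sum>v\<in>U. (S u v)\<^sup>2) - 2 * r * (grading_weight (lev u) * (br H u \<bullet> u)) + r\<^sup>2 * (grading_weight (lev u))\<^sup>2"
    if u: "u \<in> U" for u
  proof -
    have "(\<Sum>v\<in>U. (S u v - (if u = v then r * grading_weight (lev u) else 0))\<^sup>2)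
      = (\<Sum>v\<in>U. (S u v)\<^sup>2 + (if u = v then (r * grading_weight (lev u))\<^sup>2 - 2 * r * grading_weight (lev u) * S u u else 0))"
      by (intro sum.cong refl) (auto simp: power2_diff)
    also have "\<dots> = (\<Sum>v\<in>U. (S u v)\<^sup>2) + ((r * grading_weight (lev u))\<^sup>2 - 2 * r * grading_weight (lev u) * S u u)"
      using u finite_U by (simp add: sum.distrib)
    finally show ?thesis by (simp add: S_def power_mult_distrib)
  qed
  have "(\<Sum>u\<in>U. \<Sum>v\<in>U. (S u v - (if u = v then r * grading_weight (lev u) else 0))\<^sup>2)
      = (\<Sum>u\<in>U. \<Sum>v\<in>U. (S u v)\<^sup>2) - 2 * r * (\<Sum>u\<in>U. grading_weight (lev u) * (br H u \<bullet> u))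
        + r\<^sup>2 * (\<Sum>u\<in>U. (grading_weight (lev u))\<^sup>2)"
    by (simp add: diag sum.distrib sum_subtractf sum_distrib_left)
  also have "\<dots> = - c * h - 2 * r * (3 / 2 * h) + r\<^sup>2 * 18"
    using symmetric_part_norm grading_weight_facts(1,3) by (simp add: S_def h_def)
  also have "\<dots> = - c * h - h\<^sup>2 / 8"
    by (simp add: r_def power2_eq_square field_simps)
  finally have dist: "(\<Sum>u\<in>U. \<Sum>v\<in>U. (S u v - (if u = v then r * grading_weight (lev u) else 0))\<^sup>2)
      = - c * h - h\<^sup>2 / 8" .
  have "0 \<le> (\<Sum>u\<in>U. \<Sum>v\<in>U. (S u v - (if u = v then r * grading_weight (lev u) else 0))\<^sup>2)"
    by (intro sum_nonneg) simp
  then have upper: "h * (h + 8 * c) \<le> 0"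
    unfolding dist by (simp add: power2_eq_square algebra_simps)
  show hc: "H \<bullet> H = - 8 * c"
  proof (cases "h = 0")
    case True
    then show ?thesis using lower einstein_constant_nonpos by (simp add: h_def)
  next
    case False
    then show ?thesis
      using upper lower h unfolding h_def[symmetric] by (simp add: mult_le_0_iff)
  qed
  show "br H u \<bullet> u = (H \<bullet> H) / 12 * grading_weight (lev u)" if u: "u \<in> U"
  proof -
    have "- c * h - h\<^sup>2 / 8 = 0" using hc by (simp add: h_def power2_eq_square)
    then have "(\<Sum>u\<in>U. \<Sum>v\<in>U. (S u v - (if u = v then r * grading_weight (lev u) else 0))\<^sup>2) = 0"
      unfolding dist .
    then have "(\<Sum>v\<in>U. (S u v - (if u = v then r * grading_weight (lev u) else 0))\<^sup>2) = 0"
      using u finite_U by (subst (asm) sum_nonneg_eq_0_iff) (auto intro: sum_nonneg)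
    then have "(S u u - (if u = u then r * grading_weight (lev u) else 0))\<^sup>2 = 0"
      using u finite_U by (subst (asm) sum_nonneg_eq_0_iff) auto
    then show ?thesis by (simp add: S_def r_def h_def)
  qed
qed

text \<open>Since \<open>h = - 8 c\<close>, the weighted sum for the grading weights is zero.  The only structure constants
  with positive weight are those that map the quotient of the nilradical by its centre into the centre.\<close>

lemma ad_level_5_no_central_component:
  assumes "u \<in> U" "v \<in> U" "w \<in> U" "lev u = 5" "lev v \<in> {3, 4}" "lev w \<in> {1, 2}"
  shows "br u v \<bullet> w = 0"
proof -
  have G5: "grading_weight 5 = 0" by (simp add: grading_weight_def)
  have "(\<Sum>u\<in>U. \<Sum>v\<in>U. \<Sum>w\<in>U. (grading_weight (lev w) - grading_weight (lev u) - grading_weight (lev v)) * (br u v \<bullet> w)\<^sup>2) = 0"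
    using weighted_einstein[of grading_weight] grading_weight_facts(1,2) mean_curvature_rigid(1) G5
    by simp
  then have "(grading_weight (lev w) - grading_weight (lev u) - grading_weight (lev v)) * (br u v \<bullet> w)\<^sup>2 = 0"
    using sum3_signed_eq_0[where A = "\<lambda>u v w. (grading_weight (lev w) - grading_weight (lev u)
        - grading_weight (lev v)) * (br u v \<bullet> w)\<^sup>2", OF finite_U grading_weight_facts(4)] assms(1-3)
    by blast
  then show ?thesis using assms(4-6) by (auto simp: grading_weight_def)
qed

text \<open>The right hand side of the weighted Einstein equation vanishes for the degeneration weights: their total
  is zero, and \<open>ad H\<close> has the diagonal of a multiple of the grading operator, to which they are orthogonal.
  On the left all structure constants have weight at most zero, since the components of positive weight
  are excluded by \<open>structure_constant_levels\<close> and \<open>ad_level_5_no_central_component\<close>.  Hence all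
  structure constants of negative weight vanish: the contraction that removes \<open>[e 1, e 2]\<close> has to be trivial.\<close>

lemma degeneration_rigid:
  assumes uvw: "u \<in> U" "v \<in> U" "w \<in> U" and lev: "lev u = 4"
    and lev': "lev v \<in> {1, 2, 3, 4} \<and> lev w = 1 \<or> lev v = 4"
  shows "br u v \<bullet> w = 0"
proof (rule ccontr)
  assume nz: "br u v \<bullet> w \<noteq> 0"
  have sgn: "0 \<le> - ((degeneration_weight (lev w) - degeneration_weight (lev u) - degeneration_weight (lev v)) * (br u v \<bullet> w)\<^sup>2)"
    if "u \<in> U" "v \<in> U" "w \<in> U" for u v w
  proof (cases "br u v \<bullet> w = 0")
    case False
    have "br v u \<bullet> w \<noteq> 0" using False skew[of u v] by simp
    then have no: "\<not> (lev u = 5 \<and> lev v \<in> {3, 4} \<and> lev w \<in> {1, 2})"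
      "\<not> (lev v = 5 \<and> lev u \<in> {3, 4} \<and> lev w \<in> {1, 2})"
      using ad_level_5_no_central_component that False by blast+
    have "degeneration_weight (lev w) - degeneration_weight (lev u) - degeneration_weight (lev v) \<le> 0"
    proof -
      have five: "degeneration_weight (lev w) \<le> degeneration_weight k" if "k \<in> {1, 2, 3, 4}" "lev w \<in> {1..k}"
        "\<not> (k \<in> {3, 4} \<and> lev w \<in> {1, 2})" for k
        using that by (auto simp: degeneration_weight_def)
      from structure_constant_levels[OF that False] show ?thesis
      proof (elim disjE conjE)
        assume "lev u = 5" "lev v \<in> {1, 2, 3, 4}" "lev w \<in> {1..lev v}"
        moreover from this have "degeneration_weight (lev w) \<le> degeneration_weight (lev v)" using no by (intro five) auto
        ultimately show ?thesis by (simp add: degeneration_weight_def)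
      next
        assume "lev v = 5" "lev u \<in> {1, 2, 3, 4}" "lev w \<in> {1..lev u}"
        moreover from this have "degeneration_weight (lev w) \<le> degeneration_weight (lev u)" using no by (intro five) auto
        ultimately show ?thesis by (simp add: degeneration_weight_def)
      qed (auto simp: degeneration_weight_def)
    qed
    then show ?thesis by (simp add: mult_nonpos_nonneg)
  qed simp
  have E5: "degeneration_weight 5 = 0" by (simp add: degeneration_weight_def)
  have "(\<Sum>u\<in>U. degeneration_weight (lev u) * (br H u \<bullet> u)) = (\<Sum>u\<in>U. degeneration_weight (lev u) * ((H \<bullet> H) / 12 * grading_weight (lev u)))"
    using mean_curvature_rigid(2) by (intro sum.cong) auto
  also have "\<dots> = (H \<bullet> H) / 12 * (\<Sum>u\<in>U. degeneration_weight (lev u) * grading_weight (lev u))"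
    by (simp add: sum_distrib_left mult_ac)
  also have "(\<Sum>u\<in>U. degeneration_weight (lev u) * grading_weight (lev u)) = 0"
    using weight_total[of "\<lambda>k. degeneration_weight k * grading_weight k"] by (simp add: degeneration_weight_def grading_weight_def)
  finally have "(\<Sum>u\<in>U. degeneration_weight (lev u) * (br H u \<bullet> u)) = 0" by simp
  moreover have "(\<Sum>u\<in>U. degeneration_weight (lev u)) = 0"
    using weight_total[of degeneration_weight] by (simp add: degeneration_weight_def)
  ultimately have "(\<Sum>u\<in>U. \<Sum>v\<in>U. \<Sum>w\<in>U.
      - ((degeneration_weight (lev w) - degeneration_weight (lev u) - degeneration_weight (lev v)) * (br u v \<bullet> w)\<^sup>2)) = 0"
    using weighted_einstein[of degeneration_weight, OF E5] by (simp add: sum_negf)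
  then have "- ((degeneration_weight (lev w) - degeneration_weight (lev u) - degeneration_weight (lev v)) * (br u v \<bullet> w)\<^sup>2) = 0"
    using sum3_signed_eq_0[where A = "\<lambda>u v w. - ((degeneration_weight (lev w)
        - degeneration_weight (lev u) - degeneration_weight (lev v)) * (br u v \<bullet> w)\<^sup>2)",
        OF finite_U sgn] uvw
    by blast
  then have "degeneration_weight (lev w) - degeneration_weight (lev u) - degeneration_weight (lev v) = 0" using nz by simp
  then show False
    using structure_constant_levels[OF uvw nz] lev lev' by (auto simp: degeneration_weight_def)
qed

text \<open>The orthogonal projection of \<open>e 1\<close> or \<open>e 2\<close> to the complement of the span of \<open>e 3, \<dots>, e 9\<close>.\<close>

lemma level_4_lift:
  assumes i: "i \<in> {1, 2}"
  obtains x where "\<And>j. j \<in> {1, 2} \<Longrightarrow> x $ j = (if j = i then 1 else 0)"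
    "f x \<in> span {u \<in> U. lev u = 4}"
proof -
  have o4: "orthonormal_basis_of {u \<in> U. lev u \<le> 4} (flag 4)" and
    o3: "orthonormal_basis_of {u \<in> U. lev u \<le> 3} (flag 3)" by (simp_all add: level_onb)
  have split: "{u \<in> U. lev u \<le> 4} = {u \<in> U. lev u \<le> 3} \<union> {u \<in> U. lev u = 4}" by auto
  define a where "a = (\<Sum>u\<in>{u \<in> U. lev u = 4}. (f (e i) \<bullet> u) *\<^sub>R u)"
  define b where "b = (\<Sum>u\<in>{u \<in> U. lev u \<le> 3}. (f (e i) \<bullet> u) *\<^sub>R u)"
  have "f (e i) \<in> flag 4" by (simp flip: range_eq_flag)
  then have "f (e i) = (\<Sum>u\<in>{u \<in> U. lev u \<le> 4}. (f (e i) \<bullet> u) *\<^sub>R u)"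
    by (rule orthonormal_basis_expand[OF o4])
  also have "\<dots> = b + a"
    unfolding split a_def b_def using finite_U by (intro sum.union_disjoint) auto
  finally have ab: "f (e i) = b + a" .
  have "b \<in> span {u \<in> U. lev u \<le> 3}"
    unfolding b_def by (intro span_sum span_scale span_base)
  then have "b \<in> flag 3" using o3 by (simp add: orthonormal_basis_of_def)
  then obtain q where q: "q \<in> coordinate_subspace {3, 4, 5, 6, 7, 8, 9}" "b = f q"
    by (auto simp: flag_def level_index_def)
  have "f (e i - q) = a" using ab q(2) by (simp add: linear_diff[OF lin_f])
  moreover have "a \<in> span {u \<in> U. lev u = 4}"
    unfolding a_def by (intro span_sum span_scale span_base)
  moreover have "(e i - q) $ j = (if j = i then 1 else 0)" if "j \<in> {1, 2}" for j
    using q(1) that by (auto simp: coordinate_subspace_def axis_nth_if)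
  ultimately show thesis using that by metis
qed

lemma br_span_level_4_eq_0:
  assumes x: "x \<in> span {u \<in> U. lev u = 4}" and y: "y \<in> span {u \<in> U. lev u = 4}"
  shows "br x y = 0"
proof -
  have base: "br u v = 0" if "u \<in> {u \<in> U. lev u = 4}" "v \<in> {u \<in> U. lev u = 4}" for u v
    by (rule orthonormal_basis_zeroI[OF U_UNIV]) (use degeneration_rigid that in auto)
  have "br u y = 0" if "u \<in> {u \<in> U. lev u = 4}" for u
    by (rule linear_eq_0_on_span[OF linear_br(1) base y]) (use that in auto)
  then show ?thesis
    by (intro linear_eq_0_on_span[OF linear_br(2) _ x, of y])
qed

lemma br_span_level_4_orthogonal:
  assumes x: "x \<in> span {u \<in> U. lev u = 4}" and y: "y \<in> flag 3" and z: "z \<in> flag 1"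
  shows "br x y \<bullet> z = 0"
proof -
  have y': "y \<in> span {u \<in> U. lev u \<le> 3}" and z': "z \<in> span {u \<in> U. lev u \<le> 1}"
    using y z level_onb[of 3] level_onb[of 1] by (simp_all add: orthonormal_basis_of_def)
  have base: "br u v \<bullet> w = 0"
    if "u \<in> {u \<in> U. lev u = 4}" "v \<in> {u \<in> U. lev u \<le> 3}" "w \<in> {u \<in> U. lev u \<le> 1}" for u v w
  proof -
    have "lev v \<in> {1, 2, 3, 4}" "lev w = 1" using lev_bounds[of v] lev_bounds[of w] that by auto
    then show ?thesis using degeneration_rigid[of u v w] that by auto
  qed
  have "br u v \<bullet> z = 0" if "u \<in> {u \<in> U. lev u = 4}" "v \<in> {u \<in> U. lev u \<le> 3}" for u v
    by (rule linear_eq_0_on_span[OF _ base[OF that] z'])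
      (simp add: linear_iff inner_right_distrib)
  then have "br u y \<bullet> z = 0" if "u \<in> {u \<in> U. lev u = 4}" for u
    by (intro linear_eq_0_on_span[OF linear_inner_fun[OF linear_br(1)] _ y']) (use that in auto)
  then show ?thesis
    by (intro linear_eq_0_on_span[OF linear_inner_fun[OF linear_br(2)] _ x])
qed

lemma einstein_impossible: False
proof -
  obtain x where x: "\<And>j. j \<in> {1, 2} \<Longrightarrow> x $ j = (if j = 1 then 1 else 0)"
    "f x \<in> span {u \<in> U. lev u = 4}" using level_4_lift[of 1] by blast
  obtain y where y: "\<And>j. j \<in> {1, 2} \<Longrightarrow> y $ j = (if j = 2 then 1 else 0)"
    "f y \<in> span {u \<in> U. lev u = 4}" using level_4_lift[of 2] by blast
  have e7: "f (e 7) \<in> flag 1"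
    by (auto simp: flag_def level_index_def intro!: imageI axis_in_coordinate_subspace)
  have "f (e 7) \<noteq> 0"
    using inj_f linear_0[OF lin_f] by (metis axis_eq_0_iff injD zero_neq_one)
  have "f (mu_tilde t x y) = 0" using br_span_level_4_eq_0[OF x(2) y(2)] by (simp add: hom_f)
  then have xy: "mu_tilde t x y = 0" using inj_f linear_0[OF lin_f] by (metis injD)
  have orth: "f (mu_tilde t z (e i)) \<bullet> f (e 7) = 0"
    if "f z \<in> span {u \<in> U. lev u = 4}" "i \<in> {3, 4, 5, 6}" for z i
  proof -
    have "f (e i) \<in> flag 3"
      using that(2) by (auto simp: flag_def level_index_def intro!: imageI axis_in_coordinate_subspace)
    then show ?thesis unfolding hom_f by (intro br_span_level_4_orthogonal that(1) e7)
  qed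
  show False
    by (rule mu_tilde_no_graded_splitting[OF t, of "\<lambda>z. f z \<bullet> f (e 7)" x y])
      (use x(1) y(1) xy orth x(2) y(2) \<open>f (e 7) \<noteq> 0\<close> linear_inner_fun[OF lin_f] in auto)
qed

end

section \<open>The theorem\<close>

theorem proposition4p2:
  fixes t :: real
  assumes "t \<in> {1<..}"
  shows "\<not> einstein_nilradical TYPE('s::euclidean_space) (mu_tilde t)"
proof
  assume "einstein_nilradical TYPE('s) (mu_tilde t)"
  then obtain br :: "'s \<Rightarrow> 's \<Rightarrow> 's" and f c
    where br: "is_lie_bracket br" "solvable_lie br" "standard_metric br"
      and c: "\<And>x y. ricci br x y = c * (x \<bullet> y)"
      and f: "linear f" "inj f" "\<And>x y. f (mu_tilde t x y) = br (f x) (f y)"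
      and nil: "is_nilradical br (range f)"
    by (auto simp: einstein_nilradical_def standard_einstein_solvmanifold_def)
  interpret mu_tilde_nilradical t br f
    using assms by (intro mu_tilde_nilradical.intro br f nil) simp
  obtain U lev where U: "adapted_basis 5 flag U lev"
    using adapted_basis_exists[OF subspace_flag mono_flag flag_0] by blast
  interpret adapted_einstein t br f c U lev
    by unfold_locales (fact br(3) c U)+
  show False by (rule einstein_impossible)
qed

end
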